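(* There exist constants $C_1'>0$ and $C_2'>0$ such that the following holds. Let $\alpha,\beta:\mathbb{N}\to\mathbb{R}_{>0}$ be functions, and let $\lambda\vdash n$ have numbers of rows and columns at most $\alpha(n)$ and $\mu\vdash k$ have numbers of rows and columns at most $\beta(k)$, with $k<C_1'\,n/\alpha(n)$. Then $$A_{\lambda/\mu}\le e^{C_2'\,k\beta(k)n^{-1}\alpha(n)}.$$
   Context: For a partition $\nu$, $f^\nu$ denotes the number of standard Young tableaux of shape $\nu$; for $\mu\subseteq\lambda$, $f^{\lambda/\mu}$ denotes the number of standard Young tableaux of skew shape $\lambda/\mu$. $A_{\lambda/\mu}:=|\mu|!\,\frac{f^{\lambda/\mu}}{f^\lambda f^\mu}$. *)

theory Defs
  imports Complex_Main
begin

definition is_partition :: "nat list \<Rightarrow> bool" where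
  "is_partition l \<longleftrightarrow> sorted_wrt (\<ge>) l \<and> (\<forall>x\<in>set l. 0 < x)"

definition partition_of :: "nat \<Rightarrow> nat list \<Rightarrow> bool" where
  "partition_of n l \<longleftrightarrow> is_partition l \<and> sum_list l = n"

definition num_rows :: "nat list \<Rightarrow> nat" where
  "num_rows l = length l"

definition num_cols :: "nat list \<Rightarrow> nat" where
  "num_cols l = (case l of [] \<Rightarrow> 0 | x # _ \<Rightarrow> x)"

text \<open>Young diagram (English convention, 0-indexed row, column).\<close>
definition diagram :: "nat list \<Rightarrow> (nat \<times> nat) set" where
  "diagram l = {(i, j). i < length l \<and> j < l ! i}"

definition skew_diagram :: "nat list \<Rightarrow> nat list \<Rightarrow> (nat \<times> nat) set" where
  "skew_diagram l m = diagram l - diagram m"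

text \<open>Standard Young tableaux of the skew shape l/m: bijective fillings of the
  cells by 1..(number of cells), strictly increasing along rows and down columns
  (equivalently: order preserving for the componentwise order), normalised to 0
  outside the shape.\<close>
definition SYT_skew :: "nat list \<Rightarrow> nat list \<Rightarrow> ((nat \<times> nat) \<Rightarrow> nat) set" where
  "SYT_skew l m = {T. bij_betw T (skew_diagram l m) {1..card (skew_diagram l m)}
      \<and> (\<forall>c. c \<notin> skew_diagram l m \<longrightarrow> T c = 0)
      \<and> (\<forall>i j. (i, j) \<in> skew_diagram l m \<longrightarrow> (i, Suc j) \<in> skew_diagram l m
              \<longrightarrow> T (i, j) < T (i, Suc j))
      \<and> (\<forall>i j. (i, j) \<in> skew_diagram l m \<longrightarrow> (Suc i, j) \<in> skew_diagram l m
              \<longrightarrow> T (i, j) < T (Suc i, j))}"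

definition f_skew :: "nat list \<Rightarrow> nat list \<Rightarrow> nat" where
  "f_skew l m = card (SYT_skew l m)"

definition f_shape :: "nat list \<Rightarrow> nat" where
  "f_shape l = f_skew l []"

definition A_skew :: "nat list \<Rightarrow> nat list \<Rightarrow> real" where
  "A_skew l m = fact (sum_list m) * real (f_skew l m) / (real (f_shape l) * real (f_shape m))"

end

theory Submission
  imports Defs "HOL-Computational_Algebra.Formal_Power_Series"
begin

text \<open>
  The shifted Schur function of Okounkov and Olshanski satisfies
  $s^*_\mu(\lambda) = n(n-1)\cdots(n-k+1) f^{\lambda/\mu}/f^\lambda$ and branches over the rows
  of $\lambda$: removing the first row $x$ replaces $\mu$ by some $\nu$ with $\mu/\nu$ a horizontal
  strip, at the cost $\prod (x - c)$ over the contents $c$ of the strip. Bounding each factor by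
  $y = x + \beta$ reduces the theorem to estimating
  $\sum_{m} \prod_i y_i^{m_i}\, N(m)$, where $N(m)$ counts the ways of stripping $\mu$ by horizontal
  strips of sizes $m_1, m_2, \ldots$.

  Stripping $m$ cells from a shape $\nu$ of size $j$ loses only a factor $1/m! + O(1)^m \beta/j$
  with respect to $f^\nu$, because the strips are counted by $f^{\nu/(m)}$, to which the same
  branching rule applies with $\mu = (m)$. Single-cell strips commute with all others, so the strips
  of size at least two can be taken off first, while the shape still has size at least $k/2$. The sum
  over $m$ is then a coefficient of $\prod_i (e^{y_i z} + O(\beta/k)(y_i z)^2)$, which exceeds
  $(\sum_i y_i)^k/k!$ by a factor at most
  $\exp(O(\beta k) \max_i y_i / \sum_i y_i)$.
\<close>

section \<open>Partitions as functions\<close>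

text \<open>What has to be shown about N(m) is that it is close to f^\<mu> / prod_i m_i!. Then the
  sum over m is close to f^\<mu> Y^k / k! with Y = sum_i y_i, which cancels against n(n-1)...(n-k+1)
  up to the harmless ratio (Y/(n-k))^k.

  The obstacle is precision. The exponent k \<beta> \<alpha> / n may be far below 1, so a constant
  factor lost per strip would be fatal: strips of one cell have to be treated exactly. A larger
  strip may lose something because its term begins with (y z)^2; at the saddle point z = k/Y the
  total loss is of order (\<beta>/k) sum_i (y_i k/Y)^2, at most \<beta> k max_i y_i / Y. This needs
  every loss to be \<beta>/k rather than \<beta>/j with small j, which is what forces the
  reordering.

  Shapes with few single-cell strips escape that argument. They are absorbed by a crude weight 4^m
  per large strip, damped by 2^(-k).

  The hypothesis on k also controls the shift in y = x + \<beta>: since n \<le> \<alpha>^2, it makes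
  k, and with it the size of \<mu> in both directions, smaller than \<alpha>.\<close>

text \<open>A partition is represented by its row lengths, as an antitone function of finite support.\<close>

definition young :: "(nat \<Rightarrow> nat) \<Rightarrow> bool" where
  "young p \<longleftrightarrow> (\<forall>i. p (Suc i) \<le> p i) \<and> finite {i. p i \<noteq> 0}"

definition cells :: "(nat \<Rightarrow> nat) \<Rightarrow> (nat \<times> nat) set" where
  "cells p = {(i, j). j < p i}"

definition csize :: "(nat \<Rightarrow> nat) \<Rightarrow> nat" where
  "csize p = card (cells p)"

definition inc :: "(nat \<Rightarrow> nat) \<Rightarrow> nat \<Rightarrow> nat \<Rightarrow> nat" where
  "inc p i = p(i := Suc (p i))"

definition dec :: "(nat \<Rightarrow> nat) \<Rightarrow> nat \<Rightarrow> nat \<Rightarrow> nat" where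
  "dec p i = p(i := p i - 1)"

definition addable :: "(nat \<Rightarrow> nat) \<Rightarrow> nat set" where
  "addable p = {i. i = 0 \<or> p i < p (i - 1)}"

definition removable :: "(nat \<Rightarrow> nat) \<Rightarrow> nat set" where
  "removable p = {i. p (Suc i) < p i}"

text \<open>The interlacing condition \<open>p (Suc i) \<le> q i\<close> says that no two cells of p
  outside q share a column; it also makes q antitone when p is.\<close>

definition hstrip :: "(nat \<Rightarrow> nat) \<Rightarrow> (nat \<Rightarrow> nat) \<Rightarrow> bool" where
  "hstrip q p \<longleftrightarrow> (\<forall>i. q i \<le> p i \<and> p (Suc i) \<le> q i)"

lemma young_zero [simp]: "young (\<lambda>_. 0)"
  by (simp add: young_def)

lemma young_Suc: "young p \<Longrightarrow> p (Suc i) \<le> p i"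
  by (simp add: young_def)

lemma young_mono: "young p \<Longrightarrow> i \<le> j \<Longrightarrow> p j \<le> p i"
  by (rule lift_Suc_antimono_le) (auto simp: young_def)

lemma young_finite_support: "young p \<Longrightarrow> finite {i. p i \<noteq> 0}"
  by (simp add: young_def)

lemma young_bounded_support:
  assumes "young p" obtains L where "\<And>i. L \<le> i \<Longrightarrow> p i = 0"
  using young_finite_support[OF assms] unfolding finite_nat_set_iff_bounded
  by (metis (mono_tags, lifting) mem_Collect_eq not_le)

lemma young_if_bounded:
  "(\<And>i. p (Suc i) \<le> p i) \<Longrightarrow> (\<And>i. L \<le> i \<Longrightarrow> p i = 0) \<Longrightarrow> young p"
  unfolding young_def finite_nat_set_iff_bounded by (metis (mono_tags, lifting) mem_Collect_eq not_le)

lemma finite_cells: "finite {i. p i \<noteq> 0} \<Longrightarrow> finite (cells p)"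
proof -
  assume "finite {i. p i \<noteq> 0}"
  then have "finite (SIGMA i:{i. p i \<noteq> 0}. {..<p i})" by auto
  moreover have "cells p = (SIGMA i:{i. p i \<noteq> 0}. {..<p i})" by (auto simp: cells_def)
  ultimately show ?thesis by simp
qed

lemma young_finite_cells [simp]: "young p \<Longrightarrow> finite (cells p)"
  by (simp add: finite_cells young_def)

lemma csize_eq_sum:
  assumes "\<And>i. L \<le> i \<Longrightarrow> p i = 0"
  shows "csize p = (\<Sum>i<L. p i)"
proof -
  have "cells p = (SIGMA i:{..<L}. {..<p i})"
    using assms by (auto simp: cells_def) (metis not_le not_less_zero)
  then show ?thesis by (simp add: csize_def)
qed

lemma csize_zero [simp]: "csize (\<lambda>_. 0) = 0"
  by (simp add: csize_def cells_def)

lemma csize_eq_0_iff: "young p \<Longrightarrow> csize p = 0 \<longleftrightarrow> p = (\<lambda>_. 0)"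
  using young_finite_cells[of p] by (auto simp: csize_def cells_def fun_eq_iff)

section \<open>Adding and removing corner cells\<close>

lemma cells_inc: "cells (inc p i) = insert (i, p i) (cells p)"
  by (auto simp: cells_def inc_def less_Suc_eq split: if_splits)

lemma csize_inc: "young p \<Longrightarrow> csize (inc p i) = Suc (csize p)"
  unfolding csize_def cells_inc by (subst card_insert_disjoint) (simp_all, simp add: cells_def)

lemma young_inc_iff: "young p \<Longrightarrow> young (inc p i) \<longleftrightarrow> i \<in> addable p"
proof
  assume p: "young p" and q: "young (inc p i)"
  show "i \<in> addable p"
    using young_Suc[OF q, of "i - 1"] by (cases i) (auto simp: addable_def inc_def)
next
  assume p: "young p" and i: "i \<in> addable p"
  have "finite {j. inc p i j \<noteq> 0}"
    by (rule finite_subset[of _ "insert i {j. p j \<noteq> 0}"])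
      (use young_finite_support[OF p] in \<open>auto simp: inc_def split: if_splits\<close>)
  moreover have "inc p i (Suc j) \<le> inc p i j" for j
    using young_Suc[OF p, of j] i by (auto simp: inc_def addable_def split: if_splits)
  ultimately show "young (inc p i)" by (simp add: young_def)
qed

lemma young_dec: "young p \<Longrightarrow> i \<in> removable p \<Longrightarrow> young (dec p i)"
proof -
  assume p: "young p" and i: "i \<in> removable p"
  have "finite {j. dec p i j \<noteq> 0}"
    by (rule finite_subset[of _ "{j. p j \<noteq> 0}"])
      (use young_finite_support[OF p] in \<open>auto simp: dec_def split: if_splits\<close>)
  moreover have "dec p i (Suc j) \<le> dec p i j" for j
    using young_Suc[OF p, of j] i by (auto simp: dec_def removable_def split: if_splits)
  ultimately show "young (dec p i)" by (simp add: young_def)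
qed

lemma inc_dec: "0 < p i \<Longrightarrow> inc (dec p i) i = p"
  by (auto simp: inc_def dec_def)

lemma dec_inc [simp]: "dec (inc p i) i = p"
  by (auto simp: inc_def dec_def)

lemma removable_inc: "young p \<Longrightarrow> i \<in> removable (inc p i)"
  using young_Suc[of p i] by (auto simp: removable_def inc_def)

lemma removable_pos: "i \<in> removable p \<Longrightarrow> 0 < p i"
  by (auto simp: removable_def)

lemma addable_dec: "young p \<Longrightarrow> i \<in> removable p \<Longrightarrow> i \<in> addable (dec p i)"
  by (metis inc_dec removable_pos young_dec young_inc_iff)

lemma csize_dec: "young p \<Longrightarrow> i \<in> removable p \<Longrightarrow> Suc (csize (dec p i)) = csize p"
  by (metis csize_inc inc_dec removable_pos young_dec)

lemma finite_removable [simp]: "young p \<Longrightarrow> finite (removable p)"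
  by (rule finite_subset[OF _ young_finite_support]) (auto simp: removable_def)

lemma finite_addable [simp]:
  assumes "young p" shows "finite (addable p)"
proof -
  have "addable p \<subseteq> insert 0 (Suc ` {i. p i \<noteq> 0})"
  proof
    fix i assume "i \<in> addable p"
    then show "i \<in> insert 0 (Suc ` {i. p i \<noteq> 0})"
      by (cases i) (auto simp: addable_def)
  qed
  then show ?thesis using young_finite_support[OF assms] by (meson finite.insertI finite_imageI finite_subset)
qed

lemma inc_inject: "inc p i = inc p j \<longleftrightarrow> i = j"
  unfolding inc_def by (metis fun_upd_other fun_upd_same n_not_Suc_n)

section \<open>Shapes below a fixed shape\<close>

lemma young_hstrip:
  assumes "young p" "hstrip q p" shows "young q"
proof -
  have "finite {j. q j \<noteq> 0}"
    by (rule finite_subset[OF _ young_finite_support[OF assms(1)]])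
      (metis (mono_tags, lifting) Collect_mono_iff assms(2) hstrip_def le_zero_eq)
  moreover have "q (Suc j) \<le> q j" for j
    using assms(2) by (meson hstrip_def order_trans)
  ultimately show ?thesis by (simp add: young_def)
qed

lemma finite_below:
  assumes "finite {i. p i \<noteq> (0::nat)}" shows "finite {q. \<forall>i. q i \<le> p i}"
proof (rule finite_subset)
  show "{q. \<forall>i. q i \<le> p i} \<subseteq> {q. \<forall>i. (i \<in> {i. p i \<noteq> 0} \<longrightarrow> q i \<in> {..Max (p ` {i. p i \<noteq> 0})}) \<and> (i \<notin> {i. p i \<noteq> 0} \<longrightarrow> q i = 0)}"
  proof -
    have "q i \<le> Max (p ` {i. p i \<noteq> 0})" if "\<forall>i. q i \<le> p i" "p i \<noteq> 0" for q i
    proof -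
      have "p i \<le> Max (p ` {i. p i \<noteq> 0})" using assms that by (intro Max_ge) auto
      then show ?thesis using that le_trans by blast
    qed
    moreover have "q i = 0" if "\<forall>i. q i \<le> p i" "p i = 0" for q i
      using that by (metis le_zero_eq)
    ultimately show ?thesis by auto
  qed
  show "finite \<dots>" by (rule finite_set_of_finite_funs) (use assms in auto)
qed

lemma finite_hstrip [simp]: "young p \<Longrightarrow> finite {q. hstrip q p}"
  by (rule finite_subset[OF _ finite_below[OF young_finite_support]]) (auto simp: hstrip_def)

lemma cells_mono: "(\<And>i. q i \<le> p i) \<Longrightarrow> cells q \<subseteq> cells p"
  by (auto simp: cells_def) (meson order_less_le_trans)

lemma csize_mono: "young p \<Longrightarrow> (\<And>i. q i \<le> p i) \<Longrightarrow> csize q \<le> csize p"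
  by (simp add: card_mono cells_mono csize_def)

lemma csize_eq_imp_eq:
  assumes "young p" "\<And>i. q i \<le> p i" "csize q = csize p" shows "q = p"
proof -
  have "cells q = cells p"
    using assms by (intro card_subset_eq) (auto simp: csize_def cells_mono)
  then have "j < q i \<longleftrightarrow> j < p i" for i j by (auto simp: cells_def set_eq_iff)
  then show ?thesis by (metis ext not_less_iff_gr_or_eq)
qed

lemma hstrip_le: "hstrip q p \<Longrightarrow> q i \<le> p i" by (simp add: hstrip_def)

lemma hstrip_csize: "young p \<Longrightarrow> hstrip q p \<Longrightarrow> csize q \<le> csize p"
  by (auto intro: csize_mono simp: hstrip_def)

lemma card_cells_diff:
  assumes "young p" "\<And>i. q i \<le> p i"
  shows "card (cells p - cells q) = csize p - csize q"
  unfolding csize_def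
  by (rule card_Diff_subset)
    (rule finite_subset[OF cells_mono young_finite_cells[OF assms(1)]] cells_mono, rule assms(2))+

section \<open>Shifted Schur functions\<close>

definition strip_weight :: "nat \<Rightarrow> (nat \<Rightarrow> nat) \<Rightarrow> (nat \<Rightarrow> nat) \<Rightarrow> real" where
  "strip_weight x p q = (\<Prod>(i, j)\<in>cells p - cells q. real x + real i - real j)"

fun shifted_schur :: "nat list \<Rightarrow> (nat \<Rightarrow> nat) \<Rightarrow> real" where
  "shifted_schur [] p = of_bool (p = (\<lambda>_. 0))"
| "shifted_schur (x # xs) p = (\<Sum>q\<in>{q. hstrip q p}. strip_weight x p q * shifted_schur xs q)"

lemma strip_weight_self [simp]: "strip_weight x p p = 1"
  by (simp add: strip_weight_def)

lemma strip_weight_inc_outer: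
  assumes "young p" "q i \<le> p i"
  shows "strip_weight x (inc p i) q = (real x + real i - real (p i)) * strip_weight x p q"
proof -
  have "cells (inc p i) - cells q = insert (i, p i) (cells p - cells q)"
    using assms by (auto simp: cells_inc) (auto simp: cells_def)
  moreover have "(i, p i) \<notin> cells p - cells q" by (simp add: cells_def)
  ultimately show ?thesis using assms(1) by (simp add: strip_weight_def)
qed

lemma strip_weight_inc_inner:
  assumes "young p" "q i < p i"
  shows "strip_weight x p q = (real x + real i - real (q i)) * strip_weight x p (inc q i)"
proof -
  have "cells p - cells q = insert (i, q i) (cells p - cells (inc q i))"
    using assms by (auto simp: cells_inc) (auto simp: cells_def)
  moreover have "(i, q i) \<notin> cells p - cells (inc q i)" by (simp add: cells_inc)
  ultimately show ?thesis using assms(1) by (simp add: strip_weight_def)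
qed

lemma strip_weight_inc_both:
  assumes "q i = p i" shows "strip_weight x (inc p i) (inc q i) = strip_weight x p q"
proof -
  have "cells (inc p i) - cells (inc q i) = cells p - cells q"
    using assms by (auto simp: cells_def inc_def split: if_splits)
  then show ?thesis by (simp add: strip_weight_def)
qed

section \<open>The Pieri rule\<close>

text \<open>The indices i > 0 on the left are the successors of the indices j on the right. Each
  such pair differs by q j - p (Suc j), a quantity that vanishes in all other rows, so summing it
  over all rows gives the size of q minus that of p without its first row. The index 0 supplies x -
  p 0.\<close>

lemma shifted_schur_pieri_local:
  assumes p: "young p" and q: "hstrip q p"
  shows "(\<Sum>i | i = 0 \<or> p i < q (i - 1). real x + real i - real (p i)) =
    real x - (real (csize p) - real (csize q)) +
    (\<Sum>j | p (Suc j) < q j. real x + real j - real (q j - 1))"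
proof -
  have yq: "young q" using p q by (rule young_hstrip)
  obtain L where L: "\<And>i. L \<le> i \<Longrightarrow> p i = 0" using young_bounded_support[OF p] by blast
  have Lq: "\<And>i. L \<le> i \<Longrightarrow> q i = 0" using L q by (metis hstrip_def le_zero_eq)
  define C where "C = {j. p (Suc j) < q j}"
  have CL: "C \<subseteq> {..<L}" unfolding C_def using Lq by (auto intro!: leI) (metis leI not_less0)
  then have fC: "finite C" by (rule finite_subset) simp
  have "{i. i = 0 \<or> p i < q (i - 1)} = insert 0 (Suc ` C)"
    by (auto simp: C_def image_iff gr0_conv_Suc) (metis Suc_pred neq0_conv)
  then have "(\<Sum>i | i = 0 \<or> p i < q (i - 1). real x + real i - real (p i)) =
      real x - real (p 0) + (\<Sum>j\<in>C. real x + real (Suc j) - real (p (Suc j)))"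
    using fC by (simp add: sum.reindex)
  also have "\<dots> = real x - real (p 0) + ((\<Sum>j\<in>C. real x + real j - real (q j - 1)) + (\<Sum>j\<in>C. real (q j) - real (p (Suc j))))"
    unfolding sum.distrib[symmetric]
    by (intro arg_cong2[of _ _ _ _ "(+)"] sum.cong refl) (auto simp: C_def of_nat_diff)
  also have "(\<Sum>j\<in>C. real (q j) - real (p (Suc j))) = (\<Sum>j<L. real (q j) - real (p (Suc j)))"
    using CL q by (intro sum.mono_neutral_left) (auto simp: C_def hstrip_def not_less intro: le_antisym)
  also have "\<dots> = real (csize q) - (\<Sum>j<L. real (p (Suc j)))"
    using csize_eq_sum[OF Lq, of L] by (simp add: sum_subtractf)
  also have "(\<Sum>j<L. real (p (Suc j))) = real (csize p) - real (p 0)"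
  proof -
    have "csize p = (\<Sum>j<Suc L. p j)" using L by (intro csize_eq_sum) auto
    also have "\<dots> = p 0 + (\<Sum>j<L. p (Suc j))" by (rule sum.lessThan_Suc_shift)
    finally have "csize p = p 0 + (\<Sum>j<L. p (Suc j))" .
    then show ?thesis by simp
  qed
  finally show ?thesis by (simp add: C_def)
qed

text \<open>Induction on the rows. Expanding the right side gives pairs of a cell added to p and a
  strip; the induction hypothesis turns part of the left side into pairs of a strip and a cell added
  to its inner shape. Most pairs cancel, and the local identity accounts for the rest.\<close>

lemma shifted_schur_pieri:
  "young p \<Longrightarrow> (real (sum_list xs) - real (csize p)) * shifted_schur xs p =
    (\<Sum>i\<in>addable p. shifted_schur xs (inc p i))"
proof (induction xs arbitrary: p)
  case Nil
  have "inc p i \<noteq> (\<lambda>_. 0)" for i by (metis fun_upd_same inc_def nat.distinct(1))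
  then show ?case by auto
next
  case (Cons x xs)
  let ?S = "shifted_schur xs" and ?W = "strip_weight x"
  note [simp] = Cons.prems
  have yq: "young q" if "hstrip q p" for q using that by (rule young_hstrip[OF Cons.prems])
  define A where "A = (SIGMA i:addable p. {q. hstrip q (inc p i)})"
  define B where "B = (SIGMA q:{q. hstrip q p}. addable q)"
  have yA: "young q" if "(i, q) \<in> A" for i q
    using that young_hstrip[of "inc p i" q] young_inc_iff[of p i] by (auto simp: A_def)
  have finA: "finite A" unfolding A_def using young_inc_iff by (intro finite_SigmaI) auto
  have finB: "finite B" unfolding B_def using yq by (intro finite_SigmaI) auto
  define gA where "gA = (\<lambda>(i, q). ?W (inc p i) q * ?S q)"
  define gB where "gB = (\<lambda>(q, i). ?W p q * ?S (inc q i))"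
  \<comment> \<open>The cell added to p lies in the strip for A1 and in the inner shape for A2. The
    cell added to q lies inside p for B1 and outside p for B2. A2 and B2 correspond by adding the
    same cell to both shapes, which leaves the strip and its weight unchanged.\<close>
  define A1 where "A1 = {(i, q) \<in> A. hstrip q p}"
  define A2 where "A2 = {(i, q) \<in> A. \<not> hstrip q p}"
  define B1 where "B1 = {(q, i) \<in> B. hstrip (inc q i) p}"
  define B2 where "B2 = {(q, i) \<in> B. \<not> hstrip (inc q i) p}"
  have A12: "A = A1 \<union> A2" "A1 \<inter> A2 = {}" "finite A1" "finite A2"
    using finA finite_subset[of A1 A] finite_subset[of A2 A] by (auto simp: A1_def A2_def)
  have B12: "B = B1 \<union> B2" "B1 \<inter> B2 = {}" "finite B1" "finite B2"
    using finB finite_subset[of B1 B] finite_subset[of B2 B] by (auto simp: B1_def B2_def)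
  have A2': "q i = Suc (p i) \<and> hstrip (dec q i) p \<and> i \<in> removable q \<and> i \<in> addable p"
    if "(i, q) \<in> A2" for i q
  proof -
    have h: "hstrip q (inc p i)" "\<not> hstrip q p" "i \<in> addable p"
      using that by (auto simp: A2_def A_def)
    have 1: "q i = Suc (p i)"
    proof (rule ccontr)
      assume "q i \<noteq> Suc (p i)"
      have "hstrip q p" unfolding hstrip_def
      proof (intro allI conjI)
        fix j
        show "q j \<le> p j" using h(1) \<open>q i \<noteq> Suc (p i)\<close> unfolding hstrip_def inc_def
          by (metis fun_upd_apply le_SucE)
        show "p (Suc j) \<le> q j" using h(1) unfolding hstrip_def inc_def
          by (metis Suc_leD fun_upd_apply)
      qed
      with h(2) show False by simp
    qed
    have 2: "hstrip (dec q i) p" unfolding hstrip_def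
    proof (intro allI conjI)
      fix j
      show "dec q i j \<le> p j" using h(1) 1 unfolding hstrip_def inc_def dec_def
        by (metis diff_Suc_1 fun_upd_apply order_refl)
      show "p (Suc j) \<le> dec q i j" using h(1) 1 young_Suc[OF Cons.prems, of j]
        unfolding hstrip_def inc_def dec_def
        by (metis Suc_leD diff_Suc_1 fun_upd_apply)
    qed
    have "q (Suc i) \<le> p (Suc i)" using h(1) unfolding hstrip_def inc_def
      by (metis fun_upd_apply n_not_Suc_n)
    then have 3: "i \<in> removable q" using 1 young_Suc[OF Cons.prems, of i] by (simp add: removable_def)
    show ?thesis using 1 2 3 h(3) by simp
  qed
  have B2': "q i = p i \<and> hstrip (inc q i) (inc p i) \<and> i \<in> addable p \<and> \<not> hstrip (inc q i) p \<and> hstrip q p \<and> i \<in> addable q"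
    if "(q, i) \<in> B2" for i q
  proof -
    have h: "hstrip q p" "\<not> hstrip (inc q i) p" "i \<in> addable q"
      using that by (auto simp: B2_def B_def)
    have hh: "q j \<le> p j" "p (Suc j) \<le> q j" for j using h(1) by (auto simp: hstrip_def)
    have 1: "q i = p i"
    proof (rule ccontr)
      assume n: "q i \<noteq> p i"
      have "inc q i j \<le> p j" "p (Suc j) \<le> inc q i j" for j
        using hh[of j] n by (auto simp: inc_def)
      then have "hstrip (inc q i) p" by (simp add: hstrip_def)
      with h(2) show False by simp
    qed
    have 2: "i \<in> addable p"
      using h(3) 1 hh(1)[of "i - 1"] by (auto simp: addable_def)
    have "inc q i j \<le> inc p i j" "inc p i (Suc j) \<le> inc q i j" for j
      using hh[of j] h(3) 1 by (auto simp: inc_def addable_def)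
    then have 3: "hstrip (inc q i) (inc p i)" by (simp add: hstrip_def)
    show ?thesis using h 1 2 3 by simp
  qed
  have E2: "sum gA A2 = sum gB B2"
  proof (rule sum.reindex_bij_witness[where j = "\<lambda>(i, q). (dec q i, i)" and i = "\<lambda>(q, i). (i, inc q i)"])
    fix a assume a: "a \<in> A2"
    obtain i q where [simp]: "a = (i, q)" by (cases a)
    note f = A2'[OF a[simplified]]
    have yy: "young q" using yA[of i q] a by (simp add: A2_def)
    have pos: "inc (dec q i) i = q" using f by (intro inc_dec) simp
    show "(case case a of (i, q) \<Rightarrow> (dec q i, i) of (q, i) \<Rightarrow> (i, inc q i)) = a"
      using pos by simp
    show "(case a of (i, q) \<Rightarrow> (dec q i, i)) \<in> B2"
      using f pos a addable_dec[OF yy, of i] by (simp add: A2_def B2_def B_def)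
    show "gB (case a of (i, q) \<Rightarrow> (dec q i, i)) = gA a"
    proof -
      have "dec q i i = p i" using f by (simp add: dec_def)
      from strip_weight_inc_both[of "dec q i" i p x, OF this] pos show ?thesis by (simp add: gA_def gB_def)
    qed
  next
    fix b assume b: "b \<in> B2"
    obtain q i where [simp]: "b = (q, i)" by (cases b)
    note f = B2'[OF b[simplified]]
    show "(case case b of (q, i) \<Rightarrow> (i, inc q i) of (i, q) \<Rightarrow> (dec q i, i)) = b" by simp
    show "(case b of (q, i) \<Rightarrow> (i, inc q i)) \<in> A2"
      using f by (simp add: A2_def A_def)
  qed
  have A1_eq: "A1 = (\<lambda>(q, i). (i, q)) ` (SIGMA q:{q. hstrip q p}. {i. i = 0 \<or> p i < q (i - 1)})"
  proof -
    have "hstrip q p \<Longrightarrow> (i \<in> addable p \<and> hstrip q (inc p i)) \<longleftrightarrow> i = 0 \<or> p i < q (i - 1)" for q i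
    proof
      assume h: "hstrip q p" and "i \<in> addable p \<and> hstrip q (inc p i)"
      then have "inc p i (Suc (i - 1)) \<le> q (i - 1)" by (simp add: hstrip_def)
      then show "i = 0 \<or> p i < q (i - 1)" by (cases i) (auto simp: inc_def)
    next
      assume h: "hstrip q p" and i: "i = 0 \<or> p i < q (i - 1)"
      have hh: "q j \<le> p j" "p (Suc j) \<le> q j" for j using h by (auto simp: hstrip_def)
      have "q j \<le> inc p i j" "inc p i (Suc j) \<le> q j" for j
        using hh[of j] i by (auto simp: inc_def)
      then have "hstrip q (inc p i)" by (simp add: hstrip_def)
      moreover have "i \<in> addable p" using i hh(1)[of "i - 1"] by (auto simp: addable_def)
      ultimately show "i \<in> addable p \<and> hstrip q (inc p i)" by simp
    qed
    then have "(i, q) \<in> A1 \<longleftrightarrow> hstrip q p \<and> (i = 0 \<or> p i < q (i - 1))" for i q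
      by (auto simp: A1_def A_def)
    then show ?thesis by auto
  qed
  have fin1: "finite {i. i = 0 \<or> p i < q (i - 1)}" if "hstrip q p" for q
  proof (rule finite_subset[OF _ finite_addable[OF Cons.prems]])
    show "{i. i = 0 \<or> p i < q (i - 1)} \<subseteq> addable p"
      using that by (auto simp: addable_def hstrip_def) (meson order_less_le_trans)
  qed
  have S1: "sum gA A1 = (\<Sum>q | hstrip q p. (\<Sum>i | i = 0 \<or> p i < q (i - 1). real x + real i - real (p i)) * (?W p q * ?S q))"
  proof -
    have "sum gA A1 = (\<Sum>(q, i)\<in>(SIGMA q:{q. hstrip q p}. {i. i = 0 \<or> p i < q (i - 1)}). ?W (inc p i) q * ?S q)"
      unfolding A1_eq by (subst sum.reindex) (auto simp: gA_def inj_on_def intro!: sum.cong)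
    also have "\<dots> = (\<Sum>q | hstrip q p. \<Sum>i | i = 0 \<or> p i < q (i - 1). ?W (inc p i) q * ?S q)"
      using fin1 by (intro sum.Sigma[symmetric]) auto
    also have "\<dots> = (\<Sum>q | hstrip q p. (\<Sum>i | i = 0 \<or> p i < q (i - 1). real x + real i - real (p i)) * (?W p q * ?S q))"
      unfolding sum_distrib_right
      by (intro sum.cong refl) (auto simp: strip_weight_inc_outer hstrip_le mult.assoc)
    finally show ?thesis .
  qed
  \<comment> \<open>Reindexing by the enlarged inner shape makes the summands of S2 agree with those
    of S1 up to the two scalars compared by \<open>shifted_schur_pieri_local\<close>.\<close>
  have S2: "sum gB B1 = (\<Sum>q | hstrip q p. (\<Sum>j | p (Suc j) < q j. real x + real j - real (q j - 1)) * (?W p q * ?S q))"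
  proof -
    define C where "C = (SIGMA q:{q. hstrip q p}. {j. p (Suc j) < q j})"
    have CC: "i \<in> removable q \<and> hstrip (dec q i) p \<and> i \<in> addable (dec q i) \<and> inc (dec q i) i = q \<and> dec q i i < p i \<and> hstrip q p"
      if "(q, i) \<in> C" for q i
    proof -
      have h: "hstrip q p" "p (Suc i) < q i" using that by (auto simp: C_def)
      have hh: "q j \<le> p j" "p (Suc j) \<le> q j" for j using h by (auto simp: hstrip_def)
      have 1: "i \<in> removable q" using h(2) hh(1)[of "Suc i"] by (simp add: removable_def)
      have "dec q i j \<le> p j" "p (Suc j) \<le> dec q i j" for j
        using hh[of j] h(2) by (auto simp: dec_def)
      then have 2: "hstrip (dec q i) p" by (simp add: hstrip_def)
      have 3: "dec q i i < p i" using h(2) hh(1)[of i] by (simp add: dec_def)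
      show ?thesis using 1 2 3 h addable_dec[OF yq[OF h(1)] 1] by (simp add: inc_dec)
    qed
    have "sum gB B1 = (\<Sum>(q, j)\<in>C. (real x + real j - real (q j - 1)) * (?W p q * ?S q))"
    proof (rule sum.reindex_bij_witness[where j = "\<lambda>(q, i). (inc q i, i)" and i = "\<lambda>(q, i). (dec q i, i)"])
      fix b assume b: "b \<in> B1"
      obtain q i where [simp]: "b = (q, i)" by (cases b)
      have h: "hstrip q p" "i \<in> addable q" "hstrip (inc q i) p" using b by (auto simp: B1_def B_def)
      show "(case case b of (q, i) \<Rightarrow> (inc q i, i) of (q, i) \<Rightarrow> (dec q i, i)) = b" by simp
      have "p (Suc i) < inc q i i" using h(1) by (simp add: inc_def hstrip_def less_Suc_eq_le)
      then show "(case b of (q, i) \<Rightarrow> (inc q i, i)) \<in> C" using h by (simp add: C_def)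
      have "q i < p i" using h(3) hstrip_le[of "inc q i" p i] by (simp add: inc_def)
      then show "(case case b of (q, i) \<Rightarrow> (inc q i, i) of (q, j) \<Rightarrow> (real x + real j - real (q j - 1)) * (?W p q * ?S q)) = gB b"
        by (simp add: gB_def strip_weight_inc_inner[of p q i x]) (simp add: inc_def)
    next
      fix c assume c: "c \<in> C"
      obtain q i where [simp]: "c = (q, i)" by (cases c)
      note f = CC[OF c[simplified]]
      show "(case case c of (q, i) \<Rightarrow> (dec q i, i) of (q, i) \<Rightarrow> (inc q i, i)) = c" using f by simp
      show "(case c of (q, i) \<Rightarrow> (dec q i, i)) \<in> B1" using f by (simp add: B1_def B_def)
    qed
    also have "\<dots> = (\<Sum>q | hstrip q p. \<Sum>j | p (Suc j) < q j. (real x + real j - real (q j - 1)) * (?W p q * ?S q))"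
      unfolding C_def
    proof (intro sum.Sigma[symmetric] ballI)
      fix q assume "q \<in> {q. hstrip q p}"
      then have "{j. p (Suc j) < q j} \<subseteq> {j. q j \<noteq> 0}" "young q" using yq by auto
      then show "finite {j. p (Suc j) < q j}" using young_finite_support finite_subset by blast
    qed simp
    finally show ?thesis by (simp add: sum_distrib_right)
  qed
  have "(\<Sum>i\<in>addable p. shifted_schur (x # xs) (inc p i)) = sum gA A"
    unfolding A_def gA_def using young_inc_iff by (subst sum.Sigma[symmetric]) auto
  also have "\<dots> = sum gA A1 + sum gA A2" using A12 by (simp add: sum.union_disjoint)
  also have "sum gA A1 = (\<Sum>q | hstrip q p. (real x - (real (csize p) - real (csize q))) * (?W p q * ?S q)) + sum gB B1"
    unfolding S1 S2 sum.distrib[symmetric]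
    by (intro sum.cong refl) (simp only: mem_Collect_eq shifted_schur_pieri_local[OF Cons.prems] distrib_right)
  also have "\<dots> + sum gA A2 = (\<Sum>q | hstrip q p. (real x - (real (csize p) - real (csize q))) * (?W p q * ?S q)) + sum gB B"
    using B12 by (simp add: sum.union_disjoint E2)
  also have "sum gB B = (\<Sum>q | hstrip q p. \<Sum>i\<in>addable q. ?W p q * ?S (inc q i))"
    unfolding B_def gB_def using yq by (intro sum.Sigma[symmetric]) auto
  also have "\<dots> = (\<Sum>q | hstrip q p. ?W p q * ((real (sum_list xs) - real (csize q)) * ?S q))"
    by (intro sum.cong refl) (simp add: Cons.IH[OF yq] sum_distrib_left)
  also have "(\<Sum>q | hstrip q p. (real x - (real (csize p) - real (csize q))) * (?W p q * ?S q)) + \<dots>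
     = (real (sum_list (x # xs)) - real (csize p)) * shifted_schur (x # xs) p"
    by (simp add: sum.distrib[symmetric] sum_distrib_left) (auto intro!: sum.cong simp: algebra_simps)
  finally show ?case by simp
qed

section \<open>Chains of partitions\<close>

definition down :: "((nat \<Rightarrow> nat) \<Rightarrow> real) \<Rightarrow> (nat \<Rightarrow> nat) \<Rightarrow> real" where
  "down g p = (\<Sum>i\<in>removable p. g (dec p i))"

definition delta :: "(nat \<Rightarrow> nat) \<Rightarrow> (nat \<Rightarrow> nat) \<Rightarrow> real" where
  "delta q p = of_bool (p = q)"

text \<open>The number of paths of length n from p down to q in Young's lattice. It is encoded as a
  power of an operator on functions so that other operators can be commuted past it.\<close>

definition chains :: "(nat \<Rightarrow> nat) \<Rightarrow> nat \<Rightarrow> (nat \<Rightarrow> nat) \<Rightarrow> real" where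
  "chains q n = (down ^^ n) (delta q)"

lemma down_cong:
  "young p \<Longrightarrow> (\<And>r. young r \<Longrightarrow> g r = h r) \<Longrightarrow> down g p = down h p"
  by (simp add: down_def young_dec)

lemma down_mono:
  "young p \<Longrightarrow> (\<And>r. young r \<Longrightarrow> g r \<le> h r) \<Longrightarrow> down g p \<le> down h p"
  by (auto simp: down_def young_dec intro!: sum_mono)

lemma funpow_down_cong:
  "young p \<Longrightarrow> (\<And>r. young r \<Longrightarrow> g r = h r) \<Longrightarrow> (down ^^ n) g p = (down ^^ n) h p"
  by (induction n arbitrary: p) (auto intro: down_cong)

lemma funpow_down_mono:
  "young p \<Longrightarrow> (\<And>r. young r \<Longrightarrow> g r \<le> h r) \<Longrightarrow> (down ^^ n) g p \<le> (down ^^ n) h p"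
  by (induction n arbitrary: p) (auto intro: down_mono)

lemma funpow_down_sum:
  "(down ^^ n) (\<lambda>r. \<Sum>i\<in>I. g i r) p = (\<Sum>i\<in>I. (down ^^ n) (g i) p)"
proof (induction n arbitrary: p)
  case (Suc n)
  then show ?case by (simp add: down_def[of _ p]) (rule sum.swap)
qed simp

lemma chains_0 [simp]: "chains q 0 p = of_bool (p = q)"
  by (simp add: chains_def delta_def)

lemma chains_Suc_down: "chains q (Suc n) p = (\<Sum>i\<in>removable p. chains q n (dec p i))"
  by (simp add: chains_def down_def)

lemma chains_nonneg: "0 \<le> chains q n p"
proof (induction n arbitrary: p)
  case (Suc n) then show ?case by (simp add: chains_Suc_down sum_nonneg)
qed simp

text \<open>The innermost \<open>down\<close> acts on \<open>delta q\<close> and yields the sum of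
  \<open>delta (inc q i)\<close>, so it is the lowest step that is split off. This is the direction
  of the Pieri rule, which enlarges the inner shape.\<close>

lemma chains_Suc_up:
  assumes p: "young p" and q: "young q"
  shows "chains q (Suc n) p = (\<Sum>i\<in>addable q. chains (inc q i) n p)"
proof -
  have "down (delta q) r = (\<Sum>i\<in>addable q. delta (inc q i) r)" if r: "young r" for r
  proof -
    have "down (delta q) r = (\<Sum>i | i \<in> removable r \<and> dec r i = q. 1)"
      unfolding down_def delta_def of_bool_def using r by (subst sum.inter_filter) auto
    also have "{i. i \<in> removable r \<and> dec r i = q} = {i. i \<in> addable q \<and> r = inc q i}"
      using r q addable_dec inc_dec removable_pos removable_inc by fastforce
    also have "(\<Sum>i | i \<in> addable q \<and> r = inc q i. 1) = (\<Sum>i\<in>addable q. delta (inc q i) r)"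
      unfolding delta_def of_bool_def using q by (subst sum.inter_filter) auto
    finally show ?thesis .
  qed
  then have "(down ^^ n) (down (delta q)) p = (down ^^ n) (\<lambda>r. \<Sum>i\<in>addable q. delta (inc q i) r) p"
    by (intro funpow_down_cong[OF p])
  then show ?thesis by (simp add: chains_def funpow_swap1 funpow_down_sum)
qed

lemma chains_support:
  "young p \<Longrightarrow> chains q n p \<noteq> 0 \<Longrightarrow> csize p = csize q + n \<and> (\<forall>i. q i \<le> p i)"
proof (induction n arbitrary: p)
  case (Suc n)
  then obtain i where i: "i \<in> removable p" "chains q n (dec p i) \<noteq> 0"
    unfolding chains_Suc_down by (meson sum.neutral)
  have *: "csize (dec p i) = csize q + n \<and> (\<forall>j. q j \<le> dec p i j)"
    using Suc.IH[OF young_dec[OF Suc.prems(1) i(1)] i(2)] .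
  moreover have "dec p i j \<le> p j" for j by (simp add: dec_def)
  ultimately show ?case using csize_dec[OF Suc.prems(1) i(1)] le_trans by fastforce
qed auto

section \<open>Vanishing of shifted Schur functions and the branching rule\<close>

definition row_fun :: "nat list \<Rightarrow> nat \<Rightarrow> nat" where
  "row_fun xs i = (if i < length xs then xs ! i else 0)"

lemma row_fun_Nil: "row_fun [] = (\<lambda>_. 0)"
  by (auto simp: row_fun_def)

lemma row_fun_Cons_0 [simp]: "row_fun (x # xs) 0 = x"
  by (simp add: row_fun_def)

lemma row_fun_Cons_Suc [simp]: "row_fun (x # xs) (Suc i) = row_fun xs i"
  by (simp add: row_fun_def)

lemma young_row_fun: "sorted_wrt (\<ge>) xs \<Longrightarrow> young (row_fun xs)"
  by (rule young_if_bounded[where L = "length xs"]) (auto simp: row_fun_def sorted_wrt_iff_nth_less)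

lemma csize_row_fun: "csize (row_fun xs) = sum_list xs"
proof -
  have "csize (row_fun xs) = (\<Sum>i<length xs. row_fun xs i)"
    by (rule csize_eq_sum) (simp add: row_fun_def)
  then show ?thesis by (simp add: row_fun_def sum_list_sum_nth atLeast0LessThan)
qed

lemma hstrip_zero_iff: "hstrip q (\<lambda>_. 0) \<longleftrightarrow> q = (\<lambda>_. 0)"
  by (auto simp: hstrip_def fun_eq_iff)

lemma shifted_schur_zero [simp]: "shifted_schur xs (\<lambda>_. 0) = 1"
  by (induction xs) (auto simp: hstrip_zero_iff)

text \<open>If the first row of p were longer than x, the strip would contain the cell (0, x), whose
  factor x + 0 - x is zero; the inner shape cannot cover this cell because its first row is at most
  x. Lower rows are bounded by interlacing.\<close>

lemma shifted_schur_term_support: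
  assumes xs: "sorted_wrt (\<ge>) (x # xs)" and p: "young p" and q: "hstrip q p"
    and le: "\<And>i. q i \<le> row_fun xs i" and nz: "strip_weight x p q \<noteq> 0"
  shows "p i \<le> row_fun (x # xs) i"
proof (cases i)
  case 0
  have "q 0 \<le> x" using le[of 0] xs by (cases xs) (auto simp: row_fun_def)
  have "p 0 \<le> x"
  proof (rule ccontr)
    assume "\<not> p 0 \<le> x"
    with \<open>q 0 \<le> x\<close> have "(0, x) \<in> cells p - cells q" by (simp add: cells_def)
    then have "strip_weight x p q = 0"
      unfolding strip_weight_def using p by (intro prod_zero) (auto intro!: bexI[of _ "(0, x)"])
    with nz show False by simp
  qed
  then show ?thesis using 0 by simp
next
  case (Suc j)
  then show ?thesis using q le[of j] by (auto simp: hstrip_def intro: order_trans)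
qed

lemma shifted_schur_support:
  "sorted_wrt (\<ge>) xs \<Longrightarrow> young p \<Longrightarrow> shifted_schur xs p \<noteq> 0 \<Longrightarrow> p i \<le> row_fun xs i"
proof (induction xs arbitrary: p i)
  case Nil
  then show ?case by (auto split: if_splits)
next
  case (Cons x xs)
  from Cons.prems(3) obtain q where q: "hstrip q p" "strip_weight x p q * shifted_schur xs q \<noteq> 0"
    unfolding shifted_schur.simps by (metis (mono_tags, lifting) mem_Collect_eq sum.neutral)
  have "q i \<le> row_fun xs i" for i
    using Cons.IH[of q] Cons.prems q young_hstrip by auto
  then show ?case using shifted_schur_term_support[OF Cons.prems(1,2) q(1)] q(2) by auto
qed

text \<open>Induction on the number d of missing cells: the Pieri rule and
  \<open>chains_Suc_up\<close> have the same right side, and each step divides by its value of d.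
  For d = 0 the vanishing property leaves only the outer shape itself.\<close>

lemma shifted_schur_proportional:
  assumes xs: "sorted_wrt (\<ge>) xs"
  shows "young p \<Longrightarrow> csize p \<le> sum_list xs \<Longrightarrow> sum_list xs - csize p = d \<Longrightarrow>
    shifted_schur xs p = shifted_schur xs (row_fun xs) * chains p d (row_fun xs) / fact d"
proof (induction d arbitrary: p)
  case 0
  show ?case
  proof (cases "p = row_fun xs")
    case False
    then have "shifted_schur xs p = 0"
      using 0 shifted_schur_support[OF xs 0(1)] csize_eq_imp_eq[OF young_row_fun[OF xs], of p] csize_row_fun
      by (metis diff_is_0_eq le_antisym)
    then show ?thesis using False by simp
  qed simp
next
  case (Suc d)
  let ?c = "shifted_schur xs (row_fun xs)"
  have "(real (sum_list xs) - real (csize p)) * shifted_schur xs p = (\<Sum>i\<in>addable p. shifted_schur xs (inc p i))"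
    by (rule shifted_schur_pieri[OF Suc.prems(1)])
  also have "\<dots> = (\<Sum>i\<in>addable p. ?c * chains (inc p i) d (row_fun xs) / fact d)"
    using Suc.prems by (intro sum.cong refl Suc.IH) (auto simp: young_inc_iff csize_inc)
  also have "\<dots> = ?c * chains p (Suc d) (row_fun xs) / fact d"
    by (simp add: chains_Suc_up young_row_fun[OF xs] Suc.prems(1) sum_distrib_left sum_divide_distrib)
  also have "real (sum_list xs) - real (csize p) = real (Suc d)"
    using Suc.prems by linarith
  finally show ?case by (simp add: nonzero_eq_divide_eq) (simp add: algebra_simps)
qed

definition tableau_count :: "(nat \<Rightarrow> nat) \<Rightarrow> real" where
  "tableau_count p = chains (\<lambda>_. 0) (csize p) p"

text \<open>The branching rule of Okounkov and Olshanski: both sides satisfy the same Pieri recursion in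
  the inner shape and vanish for inner shapes of full size other than the outer shape.\<close>

lemma chains_eq_shifted_schur:
  assumes xs: "sorted_wrt (\<ge>) xs" and p: "young p" and le: "csize p \<le> sum_list xs"
  shows "0 < tableau_count (row_fun xs)"
    and "chains p (sum_list xs - csize p) (row_fun xs) / fact (sum_list xs - csize p) =
      shifted_schur xs p * tableau_count (row_fun xs) / fact (sum_list xs)"
proof -
  let ?c = "shifted_schur xs (row_fun xs)"
  \<comment> \<open>The unknown constant \<open>?c\<close> is found by evaluating at the empty inner
    shape, where the shifted Schur function is 1.\<close>
  have 1: "?c * tableau_count (row_fun xs) = fact (sum_list xs)"
    using shifted_schur_proportional[OF xs, of "\<lambda>_. 0"] by (simp add: tableau_count_def csize_row_fun field_simps)
  then show "0 < tableau_count (row_fun xs)"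
    by (metis chains_nonneg fact_nonzero tableau_count_def less_eq_real_def mult_zero_right)
  show "chains p (sum_list xs - csize p) (row_fun xs) / fact (sum_list xs - csize p) =
      shifted_schur xs p * tableau_count (row_fun xs) / fact (sum_list xs)"
    unfolding shifted_schur_proportional[OF xs p le refl] 1[symmetric]
    using 1 by (simp add: field_simps)
qed

lemma row_fun_surj:
  assumes "young p" obtains xs where "sorted_wrt (\<ge>) xs" "row_fun xs = p"
proof -
  obtain L where L: "\<And>i. L \<le> i \<Longrightarrow> p i = 0" using young_bounded_support[OF assms] by blast
  show thesis
  proof
    show "sorted_wrt (\<ge>) (map p [0..<L])"
      by (auto simp: sorted_wrt_iff_nth_less intro: young_mono[OF assms])
    show "row_fun (map p [0..<L]) = p" using L by (auto simp: row_fun_def fun_eq_iff)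
  qed
qed

lemma tableau_count_pos: "young p \<Longrightarrow> 0 < tableau_count p"
  by (metis chains_eq_shifted_schur(1) csize_zero le0 row_fun_surj young_zero)

section \<open>Stripping horizontal strips\<close>

text \<open>Reading g as the coefficient function of a combination of Schur functions, this is
  multiplication by the complete symmetric function h_m, by the classical Pieri rule;
  \<open>down\<close> is multiplication by h_1.\<close>

definition strips :: "nat \<Rightarrow> ((nat \<Rightarrow> nat) \<Rightarrow> real) \<Rightarrow> (nat \<Rightarrow> nat) \<Rightarrow> real" where
  "strips m g p = (\<Sum>q | hstrip q p \<and> csize p = csize q + m. g q)"

lemma finite_strips [simp]: "young p \<Longrightarrow> finite {q. hstrip q p \<and> csize p = csize q + m}"
  by (rule finite_subset[OF _ finite_hstrip[of p]]) auto

lemma strips_cong: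
  "young p \<Longrightarrow> (\<And>q. young q \<Longrightarrow> csize p = csize q + m \<Longrightarrow> g q = h q) \<Longrightarrow> strips m g p = strips m h p"
  unfolding strips_def using young_hstrip by (intro sum.cong refl) auto

lemma strips_mono:
  "young p \<Longrightarrow> (\<And>q. young q \<Longrightarrow> hstrip q p \<Longrightarrow> csize p = csize q + m \<Longrightarrow> g q \<le> h q) \<Longrightarrow> strips m g p \<le> strips m h p"
  unfolding strips_def using young_hstrip by (intro sum_mono) auto

lemma hstrip_refl: "young p \<Longrightarrow> hstrip p p"
  by (simp add: hstrip_def young_Suc)

lemma strips_0: assumes "young p" shows "strips 0 g p = g p"
proof -
  have "{q. hstrip q p \<and> csize p = csize q + 0} = {p}"
    using csize_eq_imp_eq[OF assms] hstrip_refl[OF assms] hstrip_le by fastforce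
  then show ?thesis by (simp add: strips_def)
qed

lemma strips_1: assumes p: "young p" shows "strips 1 g p = down g p"
proof -
  have "{q. hstrip q p \<and> csize p = csize q + 1} = dec p ` removable p"
  proof (intro equalityI subsetI)
    fix q assume "q \<in> {q. hstrip q p \<and> csize p = csize q + 1}"
    then have q: "hstrip q p" "csize p = csize q + 1" by auto
    then obtain i where i: "q i < p i"
      by (metis ext add_eq_self_zero hstrip_le less_le one_neq_zero)
    have r: "i \<in> removable p" using i q(1) by (auto simp: removable_def hstrip_def intro: le_less_trans)
    have "q j \<le> dec p i j" for j using hstrip_le[OF q(1), of j] i by (auto simp: dec_def)
    then have "q = dec p i"
      using csize_eq_imp_eq[OF young_dec[OF p r], of q] csize_dec[OF p r] q(2) by simp
    then show "q \<in> dec p ` removable p" using r by simp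
  next
    fix q assume "q \<in> dec p ` removable p"
    then obtain i where i: "i \<in> removable p" "q = dec p i" by auto
    have "dec p i j \<le> p j \<and> p (Suc j) \<le> dec p i j" for j
      using young_Suc[OF p, of j] i(1) by (auto simp: dec_def removable_def)
    then show "q \<in> {q. hstrip q p \<and> csize p = csize q + 1}"
      using csize_dec[OF p i(1)] i(2) by (simp add: hstrip_def)
  qed
  moreover have "inj_on (dec p) (removable p)"
    by (metis inc_dec inc_inject inj_onI removable_pos)
  ultimately show ?thesis by (simp add: strips_def down_def sum.reindex)
qed

section \<open>Commuting strips with single-cell removals\<close>

text \<open>This is h_m h_1 = h_1 h_m, proved by a bijection between the two orders of removal that
  fixes the final shape.\<close>

lemma strips_down_commute:
  assumes p: "young p" shows "strips m (down g) p = down (strips m g) p"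
proof -
  define S where "S = (SIGMA q:{q. hstrip q p \<and> csize p = csize q + m}. removable q)"
  define T where "T = (SIGMA i:removable p. {r. hstrip r (dec p i) \<and> csize (dec p i) = csize r + m})"
  \<comment> \<open>Removing the cell of row i before the strip is possible unless row i of q has
    shrunk to length \<open>p (Suc i)\<close>. In that case interlacing would break between rows i
    and i + 1, and row i + 1 of p loses the cell instead; \<open>k\<close> undoes this by comparing
    \<open>p i\<close> with \<open>r (i - 1)\<close>.\<close>
  define j where "j = (\<lambda>(q, i). (if p (Suc i) < q i then i else Suc i, dec q i))"
  define k where "k = (\<lambda>(i, r). if i = 0 \<or> p i \<le> r (i - 1) then (inc r i, i) else (inc r (i - 1), i - 1))"
  have S: "k (j (q, i)) = (q, i)" "j (q, i) \<in> T" if s: "(q, i) \<in> S" for q i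
  proof -
    have q: "hstrip q p" "csize p = csize q + m" "i \<in> removable q" using s by (auto simp: S_def)
    have yq: "young q" using young_hstrip[OF p q(1)] .
    have le: "q l \<le> p l" "p (Suc l) \<le> q l" for l using q(1) by (auto simp: hstrip_def)
    have qi: "q (Suc i) < q i" using q(3) by (simp add: removable_def)
    have sz: "csize p = Suc (csize (dec q i)) + m" using csize_dec[OF yq q(3)] q(2) by simp
    have id: "inc (dec q i) i = q" using qi by (intro inc_dec) simp
    show "k (j (q, i)) = (q, i)"
    proof (cases "p (Suc i) < q i")
      case True
      have "i = 0 \<or> p i \<le> dec q i (i - 1)" using le(2)[of "i - 1"] by (cases i) (auto simp: dec_def)
      then show ?thesis using True id by (auto simp: j_def k_def)
    next
      case False
      then have "\<not> p (Suc i) \<le> dec q i i" using le(2)[of i] qi by (simp add: dec_def)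
      then show ?thesis using False id by (simp add: j_def k_def)
    qed
    show "j (q, i) \<in> T"
    proof (cases "p (Suc i) < q i")
      case True
      have r: "i \<in> removable p" using True le(1)[of i] by (simp add: removable_def)
      have "dec q i l \<le> dec p i l" "dec p i (Suc l) \<le> dec q i l" for l
        using le[of l] True qi by (auto simp: dec_def)
      then show ?thesis using True r sz csize_dec[OF p r] by (simp add: j_def T_def hstrip_def)
    next
      case False
      then have e: "q i = p (Suc i)" using le(2)[of i] by simp
      have r: "Suc i \<in> removable p" using e qi le(2)[of "Suc i"] by (simp add: removable_def)
      have "dec q i l \<le> dec p (Suc i) l" "dec p (Suc i) (Suc l) \<le> dec q i l" for l
        using le[of l] e qi by (auto simp: dec_def)
      then show ?thesis using False r sz csize_dec[OF p r] by (simp add: j_def T_def hstrip_def)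
    qed
  qed
  have T: "j (k (i, r)) = (i, r)" "k (i, r) \<in> S" if t: "(i, r) \<in> T" for i r
  proof -
    have h: "hstrip r (dec p i)" "csize (dec p i) = csize r + m" "i \<in> removable p" using t by (auto simp: T_def)
    have yr: "young r" using young_hstrip[OF young_dec[OF p h(3)] h(1)] .
    have pi: "p (Suc i) < p i" using h(3) by (simp add: removable_def)
    have sz: "csize p = Suc (csize r) + m" using csize_dec[OF p h(3)] h(2) by simp
    have le: "r l \<le> dec p i l" "dec p i (Suc l) \<le> r l" for l using h(1) by (auto simp: hstrip_def)
    have "j (k (i, r)) = (i, r) \<and> k (i, r) \<in> S"
    proof (cases "i = 0 \<or> p i \<le> r (i - 1)")
      case True
      have "inc r i l \<le> p l" "p (Suc l) \<le> inc r i l" for l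
        using le[of l] True pi by (auto simp: inc_def dec_def split: if_splits)
      then have "hstrip (inc r i) p" by (simp add: hstrip_def)
      moreover have "p (Suc i) < inc r i i" using le(2)[of i] by (simp add: inc_def dec_def)
      ultimately show ?thesis using True sz removable_inc[OF yr, of i] csize_inc[OF yr, of i]
        by (auto simp: j_def k_def S_def)
    next
      case False
      then obtain l where l: "i = Suc l" "r l < p (Suc l)" by (cases i) auto
      have e: "Suc (r l) = p (Suc l)" using l le(2)[of l] by (simp add: dec_def)
      have "inc r l n \<le> p n" "p (Suc n) \<le> inc r l n" for n
        using le[of n] e l young_Suc[OF p, of n] by (auto simp: inc_def dec_def split: if_splits)
      then have "hstrip (inc r l) p" by (simp add: hstrip_def)
      moreover have "\<not> p (Suc l) < inc r l l" using e by (simp add: inc_def)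
      ultimately show ?thesis using l sz removable_inc[OF yr, of l] csize_inc[OF yr, of l]
        by (auto simp: j_def k_def S_def)
    qed
    then show "j (k (i, r)) = (i, r)" "k (i, r) \<in> S" by auto
  qed
  have "strips m (down g) p = (\<Sum>(q, i)\<in>S. g (dec q i))"
    unfolding strips_def down_def S_def using young_hstrip[OF p] p by (intro sum.Sigma) auto
  also have "\<dots> = (\<Sum>(i, r)\<in>T. g r)"
  proof (rule sum.reindex_bij_witness[where j = j and i = k])
    fix a assume a: "a \<in> S"
    then show "k (j a) = a" "j a \<in> T" using S by (cases a; blast)+
    show "(case j a of (i, r) \<Rightarrow> g r) = (case a of (q, i) \<Rightarrow> g (dec q i))" by (auto simp: j_def split: prod.split)
  next
    fix b assume "b \<in> T"
    then show "j (k b) = b" "k b \<in> S" using T by (cases b; blast)+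
  qed
  also have "\<dots> = down (strips m g) p"
    unfolding strips_def down_def T_def using young_dec[OF p] p by (intro sum.Sigma[symmetric]) auto
  finally show ?thesis .
qed

lemma strips_funpow_down_commute:
  "young p \<Longrightarrow> strips m ((down ^^ n) g) p = (down ^^ n) (strips m g) p"
proof (induction n arbitrary: p)
  case (Suc n)
  have "strips m ((down ^^ Suc n) g) p = down (strips m ((down ^^ n) g)) p"
    using strips_down_commute[OF Suc.prems] by simp
  also have "\<dots> = down ((down ^^ n) (strips m g)) p"
    by (rule down_cong[OF Suc.prems]) (rule Suc.IH)
  finally show ?case by simp
qed simp

section \<open>One-row shapes\<close>

lemma row_fun_single: "row_fun [m] = (\<lambda>i. if i = 0 then m else 0)"
  by (auto simp: row_fun_def)

lemma young_single [simp]: "young (row_fun [m])"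
  by (rule young_row_fun) simp

lemma csize_single [simp]: "csize (row_fun [m]) = m"
  by (simp add: csize_row_fun)

lemma single_eq_iff: "row_fun [m] = row_fun [n] \<longleftrightarrow> m = n"
  by (metis row_fun_Cons_0)

lemma hstrip_single_iff: "hstrip q (row_fun [m]) \<longleftrightarrow> (\<exists>j\<le>m. q = row_fun [j])"
proof
  assume h: "hstrip q (row_fun [m])"
  have "q i = 0" if "i \<noteq> 0" for i using hstrip_le[OF h, of i] that by (simp add: row_fun_single)
  then have "q = row_fun [q 0]" by (simp add: row_fun_single fun_eq_iff)
  moreover have "q 0 \<le> m" using hstrip_le[OF h, of 0] by (simp add: row_fun_single)
  ultimately show "\<exists>j\<le>m. q = row_fun [j]" by blast
qed (auto simp: hstrip_def row_fun_single)

lemma strips_delta_zero: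
  assumes "young p" shows "strips m (delta (\<lambda>_. 0)) p = delta (row_fun [m]) p"
proof -
  have "hstrip (\<lambda>_. 0) p \<and> csize p = m \<longleftrightarrow> p = row_fun [m]"
  proof
    assume h: "hstrip (\<lambda>_. 0) p \<and> csize p = m"
    then have "p i = 0" if "i \<noteq> 0" for i using that by (cases i) (auto simp: hstrip_def)
    then have "p = row_fun [p 0]" by (simp add: row_fun_single fun_eq_iff)
    then show "p = row_fun [m]" using h by (metis csize_single)
  qed (auto simp: hstrip_def row_fun_single[of m] csize_single[of m, unfolded row_fun_single])
  moreover have "strips m (delta (\<lambda>_. 0)) p = (\<Sum>q\<in>{q. hstrip q p \<and> csize p = csize q + m} \<inter> {\<lambda>_. 0}. 1)"
    unfolding strips_def delta_def of_bool_def using assms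
    by (subst sum.inter_restrict) (auto intro!: sum.cong)
  moreover have "{q. hstrip q p \<and> csize p = csize q + m} \<inter> {\<lambda>_. 0} =
    (if hstrip (\<lambda>_. 0) p \<and> csize p = m then {\<lambda>_. 0} else {})" by auto
  ultimately show ?thesis by (simp add: delta_def)
qed

lemma tableau_count_eq: "tableau_count p = (down ^^ csize p) (delta (\<lambda>_. 0)) p"
  by (simp add: tableau_count_def chains_def)

text \<open>Moving the strip past all single-cell removals makes it the last thing taken off, where
  it must be a full row of m cells. A sum over many inner shapes thus becomes one chain count, to
  which the branching rule applies.\<close>

lemma strips_tableau_count:
  assumes p: "young p" and m: "m \<le> csize p"
  shows "strips m tableau_count p = chains (row_fun [m]) (csize p - m) p"
proof -
  have "strips m tableau_count p = strips m ((down ^^ (csize p - m)) (delta (\<lambda>_. 0))) p"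
    by (rule strips_cong[OF p]) (simp add: tableau_count_eq)
  also have "\<dots> = (down ^^ (csize p - m)) (strips m (delta (\<lambda>_. 0))) p"
    by (rule strips_funpow_down_commute[OF p])
  also have "\<dots> = (down ^^ (csize p - m)) (delta (row_fun [m])) p"
    by (rule funpow_down_cong[OF p]) (rule strips_delta_zero)
  finally show ?thesis by (simp add: chains_def)
qed

lemma chains_zero_single: "1 \<le> chains (\<lambda>_. 0) m (row_fun [m])"
proof (induction m)
  case 0
  then show ?case by (simp add: row_fun_single)
next
  case (Suc m)
  have r: "0 \<in> removable (row_fun [Suc m])" by (simp add: removable_def row_fun_single)
  have "dec (row_fun [Suc m]) 0 = row_fun [m]" by (auto simp: dec_def row_fun_single)
  then have "1 \<le> chains (\<lambda>_. 0) m (dec (row_fun [Suc m]) 0)" using Suc by simp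
  also have "\<dots> \<le> chains (\<lambda>_. 0) (Suc m) (row_fun [Suc m])"
    unfolding chains_Suc_down using r by (intro member_le_sum) (auto simp: chains_nonneg)
  finally show ?case .
qed

text \<open>Every chain from p down to the row of length m extends to the empty shape by removing
  the cells of that row one by one.\<close>

lemma strips_tableau_count_le:
  assumes p: "young p" shows "strips m tableau_count p \<le> tableau_count p"
proof (cases "m \<le> csize p")
  case True
  have "strips m tableau_count p = (down ^^ (csize p - m)) (delta (row_fun [m])) p"
    using strips_tableau_count[OF p True] by (simp add: chains_def)
  also have "\<dots> \<le> (down ^^ (csize p - m)) ((down ^^ m) (delta (\<lambda>_. 0))) p"
    using chains_zero_single chains_nonneg
    by (intro funpow_down_mono[OF p]) (auto simp: delta_def chains_def[symmetric])
  also have "\<dots> = tableau_count p"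
    using True funpow_add[of "csize p - m" m down, THEN fun_cong, of "delta (\<lambda>_. 0)"] by (simp add: tableau_count_eq)
  finally show ?thesis .
next
  case False
  then have "strips m tableau_count p = 0" by (auto simp: strips_def intro!: sum.neutral)
  then show ?thesis using tableau_count_pos[OF p] by simp
qed

section \<open>Schur polynomials as majorants\<close>

text \<open>The ordinary Schur polynomial of p at the listed values, given by its branching
  rule.\<close>

fun strip_series :: "real list \<Rightarrow> (nat \<Rightarrow> nat) \<Rightarrow> real" where
  "strip_series [] p = of_bool (p = (\<lambda>_. 0))"
| "strip_series (y # ys) p = (\<Sum>q | hstrip q p. y ^ (csize p - csize q) * strip_series ys q)"

lemma strip_series_nonneg: "(\<And>y. y \<in> set ys \<Longrightarrow> 0 \<le> y) \<Longrightarrow> 0 \<le> strip_series ys p"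
  by (induction ys arbitrary: p) (auto intro!: sum_nonneg)

text \<open>A negative factor can occur only alongside a zero one: if the product is nonzero,
  \<open>shifted_schur_term_support\<close> gives \<open>p i \<le> x\<close> for every row, so each
  factor x + i - j is positive and at most x + l.\<close>

lemma strip_weight_bounds:
  assumes xs: "sorted_wrt (\<ge>) (x # xs)" and p: "young p" and q: "hstrip q p"
    and le: "\<And>i. q i \<le> row_fun xs i" and l: "\<And>i. l < i \<Longrightarrow> p i = 0"
  shows "0 \<le> strip_weight x p q" "strip_weight x p q \<le> (real x + real l) ^ (csize p - csize q)"
proof -
  have "0 \<le> strip_weight x p q \<and> strip_weight x p q \<le> (real x + real l) ^ (csize p - csize q)"
  proof (cases "strip_weight x p q = 0")
    case False
    have sup: "p i \<le> x" for i
      using shifted_schur_term_support[OF xs p q le False, of 0] young_mono[OF p, of 0 i] by simp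
    have b: "0 \<le> real x + real i - real j \<and> real x + real i - real j \<le> real x + real l"
      if "(i, j) \<in> cells p - cells q" for i j
    proof -
      have "j < p i" using that by (simp add: cells_def)
      moreover have "i \<le> l" using l[of i] \<open>j < p i\<close> by (cases "l < i") auto
      ultimately show ?thesis using sup[of i] by simp
    qed
    have "0 \<le> strip_weight x p q" unfolding strip_weight_def using b by (intro prod_nonneg) auto
    moreover have "strip_weight x p q \<le> (\<Prod>_\<in>cells p - cells q. real x + real l)"
      unfolding strip_weight_def using b by (intro prod_mono) auto
    ultimately show ?thesis using card_cells_diff[OF p, of q] q by (simp add: hstrip_le)
  qed auto
  then show "0 \<le> strip_weight x p q" "strip_weight x p q \<le> (real x + real l) ^ (csize p - csize q)" by auto
qed

lemma shifted_schur_le_strip_series: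
  "sorted_wrt (\<ge>) xs \<Longrightarrow> young p \<Longrightarrow> (\<And>i. l < i \<Longrightarrow> p i = 0) \<Longrightarrow>
    0 \<le> shifted_schur xs p \<and> shifted_schur xs p \<le> strip_series (map (\<lambda>x. real x + real l) xs) p"
proof (induction xs arbitrary: p)
  case (Cons x xs)
  have "0 \<le> strip_weight x p q * shifted_schur xs q \<and> strip_weight x p q * shifted_schur xs q \<le>
      (real x + real l) ^ (csize p - csize q) * strip_series (map (\<lambda>x. real x + real l) xs) q"
    if q: "hstrip q p" for q
  proof -
    have yq: "young q" using young_hstrip[OF Cons.prems(2) q] .
    have IH: "0 \<le> shifted_schur xs q" "shifted_schur xs q \<le> strip_series (map (\<lambda>x. real x + real l) xs) q"
      using Cons.IH[OF _ yq] Cons.prems(1,3) hstrip_le[OF q] by (metis le_zero_eq sorted_wrt.simps(2))+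
    show ?thesis
    proof (cases "shifted_schur xs q = 0")
      case True
      have "0 \<le> strip_series (map (\<lambda>x. real x + real l) xs) q" by (rule strip_series_nonneg) auto
      then show ?thesis using True by simp
    next
      case False
      have le: "q i \<le> row_fun xs i" for i
        using shifted_schur_support[OF _ yq False] Cons.prems(1) by auto
      show ?thesis
        using strip_weight_bounds[OF Cons.prems(1,2) q le, of l] Cons.prems(3) IH
        by (auto intro!: mult_mono)
    qed
  qed
  then show ?case by (auto intro!: sum_nonneg sum_mono)
qed auto

text \<open>Each factor (a + j) / (1 + j) is at least a. In terms of series, 1/(1 - a z) is
  dominated coefficientwise by (1 - z)^(-a).\<close>

lemma power_le_pochhammer:
  fixes a :: real assumes "0 \<le> a" "a \<le> 1" shows "a ^ i \<le> pochhammer a i / fact i"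
proof (induction i)
  case (Suc i)
  have "a * (1 + real i) \<le> a + real i"
    using mult_right_mono[OF assms(2), of "real i"] by (simp add: algebra_simps)
  then have "a \<le> (a + real i) / (1 + real i)" by (simp add: field_simps)
  moreover have "0 \<le> pochhammer a i / fact i" using Suc assms(1) by (meson order_trans zero_le_power)
  ultimately have "a ^ i * a \<le> pochhammer a i / fact i * ((a + real i) / (1 + real i))"
    using Suc assms by (intro mult_mono) auto
  then show ?case by (simp add: pochhammer_Suc mult.commute add.commute)
qed simp

text \<open>For a single row the Schur polynomial is the complete symmetric polynomial, the
  coefficient of z^m in the product of 1/(1 - y z). Each factor is dominated by (1 - b z)^(-y/b),
  and the exponents add up by the Vandermonde identity
  \<open>pochhammer_binomial_sum\<close>.\<close>

lemma strip_series_single_le: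
  assumes "0 < b"
  shows "(\<And>y. y \<in> set ys \<Longrightarrow> 0 \<le> y \<and> y \<le> b) \<Longrightarrow>
    strip_series ys (row_fun [m]) \<le> b ^ m * pochhammer (sum_list ys / b) m / fact m"
proof (induction ys arbitrary: m)
  case Nil
  have "row_fun [m] = (\<lambda>_. 0) \<longleftrightarrow> m = 0" by (auto simp: row_fun_single fun_eq_iff)
  then show ?case by (simp add: pochhammer_0_left)
next
  case (Cons y ys)
  let ?s = "sum_list ys / b"
  have s: "0 \<le> sum_list ys" using Cons.prems by (intro sum_list_nonneg) auto
  have "strip_series (y # ys) (row_fun [m]) = (\<Sum>q\<in>(\<lambda>j. row_fun [j]) ` {..m}. y ^ (m - csize q) * strip_series ys q)"
    by (auto simp: hstrip_single_iff intro!: sum.cong)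
  also have "\<dots> = (\<Sum>j\<le>m. y ^ (m - j) * strip_series ys (row_fun [j]))"
    by (subst sum.reindex) (auto simp: inj_on_def single_eq_iff)
  also have "\<dots> \<le> (\<Sum>j\<le>m. (b ^ (m - j) * (pochhammer (y / b) (m - j) / fact (m - j))) *
      (b ^ j * pochhammer ?s j / fact j))"
  proof (intro sum_mono mult_mono)
    fix j
    have "(y / b) ^ (m - j) \<le> pochhammer (y / b) (m - j) / fact (m - j)"
      using Cons.prems[of y] assms by (intro power_le_pochhammer) auto
    moreover have "0 \<le> (y / b) ^ (m - j)" using Cons.prems[of y] assms by simp
    ultimately have "0 \<le> pochhammer (y / b) (m - j) / fact (m - j)" by linarith
    then show "0 \<le> b ^ (m - j) * (pochhammer (y / b) (m - j) / fact (m - j))"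
      using assms by (intro mult_nonneg_nonneg) simp_all
    from \<open>(y / b) ^ (m - j) \<le> _\<close> show "y ^ (m - j) \<le> b ^ (m - j) * (pochhammer (y / b) (m - j) / fact (m - j))"
      using assms by (simp add: power_divide field_simps)
    show "strip_series ys (row_fun [j]) \<le> b ^ j * pochhammer ?s j / fact j" using Cons by auto
    show "0 \<le> strip_series ys (row_fun [j])" using Cons.prems by (intro strip_series_nonneg) auto
  qed
  also have "\<dots> = b ^ m / fact m * (\<Sum>j\<le>m. of_nat (m choose j) * pochhammer ?s j * pochhammer (y / b) (m - j))"
    unfolding sum_distrib_left
  proof (intro sum.cong refl)
    fix j assume "j \<in> {..m}"
    then have "b ^ m = b ^ (m - j) * b ^ j" "real (m choose j) = fact m / (fact j * fact (m - j))"
      by (auto simp: power_add[symmetric] binomial_fact)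
    then show "b ^ (m - j) * (pochhammer (y / b) (m - j) / fact (m - j)) * (b ^ j * pochhammer ?s j / fact j)
      = b ^ m / fact m * (of_nat (m choose j) * pochhammer ?s j * pochhammer (y / b) (m - j))"
      by (simp add: mult_ac)
  qed
  also have "\<dots> = b ^ m / fact m * pochhammer (?s + y / b) m"
    unfolding pochhammer_binomial_sum by simp
  finally show ?case by (simp add: add_divide_distrib add.commute)
qed

section \<open>Stripping sequences\<close>

text \<open>The left side is k(k + b)...(k + (m-1)b), to be compared factor by factor with k(k -
  1)...(k - m + 1). While 2m \<le> k, each ratio is 1 plus a multiple of
  \<open>m * \<delta>\<close>.\<close>

lemma pochhammer_le_falling:
  fixes b \<delta> :: real
  assumes b: "1 \<le> b" and d: "b \<le> \<delta> * real k" "\<delta> \<le> 2" "0 \<le> \<delta>"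
  shows "2 * m \<le> k \<Longrightarrow>
    b ^ m * pochhammer (real k / b) m \<le> fact k / fact (k - m) * (1 + \<delta> * (12 ^ m * fact m))"
proof (induction m)
  case 0
  then show ?case using d by simp
next
  case (Suc m)
  let ?X = "12 ^ m * fact m :: real"
  have X: "1 \<le> ?X" using mult_mono[of 1 "12 ^ m" 1 "fact m :: real"] by (simp add: fact_ge_1)
  have 1: "real k + real m * b \<le> (real k - real m) * (1 + 4 * real m * \<delta>)"
  proof -
    have "real (2 * m) \<le> real k" using Suc.prems by (intro of_nat_mono) simp
    then have "real k \<le> 2 * (real k - real m)" by simp
    then have "real k * (\<delta> * (2 * real m)) \<le> 2 * (real k - real m) * (\<delta> * (2 * real m))"
      using d by (intro mult_right_mono) auto
    moreover have "b * (2 * real m) \<le> \<delta> * real k * (2 * real m)"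
      using d by (intro mult_right_mono) auto
    moreover have "1 * real m \<le> b * real m" using b by (intro mult_right_mono) auto
    ultimately show ?thesis by (simp add: algebra_simps)
  qed
  \<comment> \<open>The base 12 is 4 + 2 * 4: the linear term 4 m and the product term 4 m \<delta>
    with \<delta> \<le> 2, both measured against \<open>?X\<close>.\<close>
  have 2: "(1 + \<delta> * ?X) * (1 + 4 * real m * \<delta>) \<le> 1 + \<delta> * (12 ^ Suc m * fact (Suc m))"
  proof -
    define Y where "Y = ?X"
    have "\<delta> * (4 * real m * Y) \<le> 2 * (4 * real m * Y)"
      using d X Y_def by (intro mult_right_mono) auto
    moreover have "4 * real m * 1 \<le> 4 * real m * Y" using X Y_def by (intro mult_left_mono) auto
    ultimately have "Y + 4 * real m + \<delta> * (4 * real m * Y) \<le> 12 * (1 + real m) * Y"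
    proof -
      have "12 * (1 + real m) * Y = 12 * Y + 12 * (real m * Y)" by (simp add: algebra_simps)
      moreover have "1 \<le> Y" using X Y_def by simp
      ultimately show ?thesis
        using \<open>\<delta> * (4 * real m * Y) \<le> _\<close> \<open>4 * real m * 1 \<le> _\<close> by linarith
    qed
    from mult_left_mono[OF this d(3)] have "(1 + \<delta> * Y) * (1 + 4 * real m * \<delta>) \<le> 1 + \<delta> * (12 * (1 + real m) * Y)"
      by (simp add: algebra_simps)
    moreover have "12 ^ Suc m * fact (Suc m) = 12 * (1 + real m) * Y" by (simp add: Y_def)
    ultimately show ?thesis unfolding Y_def[symmetric] by simp
  qed
  have "b ^ Suc m * pochhammer (real k / b) (Suc m) = b ^ m * pochhammer (real k / b) m * (real k + real m * b)"
    using b by (simp add: pochhammer_Suc field_simps)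
  also have "\<dots> \<le> fact k / fact (k - m) * (1 + \<delta> * ?X) * ((real k - real m) * (1 + 4 * real m * \<delta>))"
  proof (rule mult_mono)
    show "b ^ m * pochhammer (real k / b) m \<le> fact k / fact (k - m) * (1 + \<delta> * ?X)"
      using Suc by simp
    show "0 \<le> fact k / fact (k - m) * (1 + \<delta> * ?X)" using d X by simp
    show "0 \<le> real k + real m * b" using b by simp
  qed (rule 1)
  also have "\<dots> = (fact k / fact (k - m) * (real k - real m)) * ((1 + \<delta> * ?X) * (1 + 4 * real m * \<delta>))"
    by simp
  also have "fact k / fact (k - m) * (real k - real m) = fact k / fact (k - Suc m)"
  proof -
    have "k - m = Suc (k - Suc m)" using Suc.prems by simp
    then have "fact (k - m) = (real k - real m) * fact (k - Suc m)"
      using Suc.prems by (simp add: of_nat_diff)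
    moreover have "real k - real m > 0" using Suc.prems by simp
    ultimately show ?thesis by simp
  qed
  also have "fact k / fact (k - Suc m) * ((1 + \<delta> * ?X) * (1 + 4 * real m * \<delta>)) \<le>
      fact k / fact (k - Suc m) * (1 + \<delta> * (12 ^ Suc m * fact (Suc m)))"
    using 2 by (intro mult_left_mono) auto
  finally show ?case .
qed

text \<open>The branching rule with the single row (m) as inner shape turns the strip count into a
  shifted Schur value, which the complete symmetric polynomial of the row lengths of p
  dominates.\<close>

lemma strips_tableau_count_bound:
  assumes p: "young p" and b: "1 \<le> b" "p 0 \<le> b" and d: "real b \<le> \<delta> * real (csize p)" "\<delta> \<le> 2" "0 \<le> \<delta>"
    and m: "m \<le> csize p"
  shows "strips m tableau_count p \<le> tableau_count p * (1 / fact m + 12 ^ m * \<delta>)"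
proof (cases "2 * m \<le> csize p")
  case True
  let ?k = "csize p"
  obtain xs where xs: "sorted_wrt (\<ge>) xs" "row_fun xs = p" by (rule row_fun_surj[OF p])
  have sl: "sum_list xs = ?k" using csize_row_fun[of xs] xs(2) by simp
  have le: "x \<le> b" if x: "x \<in> set xs" for x
  proof -
    obtain i where "i < length xs" "xs ! i = x" using x by (auto simp: in_set_conv_nth)
    then have "x = row_fun xs i" by (simp add: row_fun_def)
    then have "x = p i" using xs(2) by simp
    then show ?thesis using young_mono[OF p, of 0 i] b by simp
  qed
  have "strips m tableau_count p / fact (?k - m) = shifted_schur xs (row_fun [m]) * tableau_count p / fact ?k"
    using chains_eq_shifted_schur(2)[OF xs(1), of "row_fun [m]"] strips_tableau_count[OF p m] m
    by (simp add: xs sl)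
  \<comment> \<open>A single row has only row index 0, so the majorant uses the row lengths with
    shift 0.\<close>
  also have "\<dots> \<le> strip_series (map (\<lambda>x. real x + real 0) xs) (row_fun [m]) * tableau_count p / fact ?k"
    using conjunct2[OF shifted_schur_le_strip_series[OF xs(1) young_single, of 0 m]] tableau_count_pos[OF p]
    by (intro divide_right_mono mult_right_mono) (auto simp: row_fun_def)
  also have "strip_series (map (\<lambda>x. real x + real 0) xs) (row_fun [m]) \<le>
      real b ^ m * pochhammer (sum_list (map (\<lambda>x. real x + real 0) xs) / real b) m / fact m"
    using b le by (intro strip_series_single_le) auto
  also have "sum_list (map (\<lambda>x. real x + real 0) xs) = real ?k"
    unfolding sl[symmetric] by (induction xs) auto
  also have "real b ^ m * pochhammer (real ?k / real b) m \<le> fact ?k / fact (?k - m) * (1 + \<delta> * (12 ^ m * fact m))"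
    using b d True by (intro pochhammer_le_falling) auto
  finally have "strips m tableau_count p / fact (?k - m) \<le>
      fact ?k / fact (?k - m) * (1 + \<delta> * (12 ^ m * fact m)) / fact m * tableau_count p / fact ?k"
    using tableau_count_pos[OF p] by (simp add: divide_right_mono mult_right_mono)
  also have "\<dots> = tableau_count p * (1 / fact m + 12 ^ m * \<delta>) / fact (?k - m)"
    by (simp add: field_simps)
  finally show ?thesis by (simp add: divide_le_cancel)
next
  case False
  then have k: "0 < real (csize p)" using b d by (cases "csize p") auto
  \<comment> \<open>When m exceeds half the size, \<open>12 ^ m * \<delta>\<close> is already at
    least 1, so the trivial bound \<open>strips_tableau_count_le\<close> is enough.\<close>
  have "real (csize p) \<le> 12 ^ m"
  proof -
    have "csize p < 2 * m" using False by simp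
    also have "m < 2 ^ m" by (rule less_exp)
    finally have "csize p < 2 * 2 ^ m" by simp
    moreover have "(2::nat) * 2 ^ m \<le> 12 ^ m"
    proof (cases m)
      case (Suc n)
      have "(2::nat) ^ n \<le> 12 ^ n" by (rule power_mono) auto
      then show ?thesis using Suc by simp
    qed (use False in simp)
    ultimately have "csize p \<le> 12 ^ m" by simp
    then show ?thesis by (metis of_nat_le_iff of_nat_numeral of_nat_power)
  qed
  then have "real (csize p) * \<delta> \<le> 12 ^ m * \<delta>" using d(3) by (rule mult_right_mono)
  then have "1 \<le> 12 ^ m * \<delta>" using b d by (simp add: mult.commute)
  then have "1 \<le> 1 / fact m + 12 ^ m * \<delta>" by (simp add: add_increasing)
  then have "tableau_count p * 1 \<le> tableau_count p * (1 / fact m + 12 ^ m * \<delta>)"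
    using tableau_count_pos[OF p] by (intro mult_left_mono) auto
  then show ?thesis using strips_tableau_count_le[OF p, of m] by simp
qed

section \<open>Iterated stripping\<close>

lemma strips_cmult: "strips m (\<lambda>q. c * g q) p = c * strips m g p"
  by (simp add: strips_def sum_distrib_left)

lemma foldr_strips_down:
  "young p \<Longrightarrow> foldr strips ms (down g) p = down (foldr strips ms g) p"
proof (induction ms arbitrary: p)
  case (Cons m ms)
  have "foldr strips (m # ms) (down g) p = strips m (down (foldr strips ms g)) p"
    using strips_cong[OF Cons.prems Cons.IH] by simp
  then show ?case using strips_down_commute[OF Cons.prems] by simp
qed simp

text \<open>The head of the list is stripped first. Parts 0 do nothing, and parts 1 are
  \<open>down\<close>, which commutes past everything and is collected at the inner end.\<close>

lemma foldr_strips_reorder: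
  "young p \<Longrightarrow> foldr strips ms (delta (\<lambda>_. 0)) p =
    foldr strips (filter (\<lambda>m. 2 \<le> m) ms) ((down ^^ count_list ms 1) (delta (\<lambda>_. 0))) p"
proof (induction ms arbitrary: p)
  case (Cons m ms)
  consider "m = 0" | "m = 1" | "2 \<le> m" by linarith
  then show ?case
  proof cases
    case 1
    have "foldr strips (0 # ms) (delta (\<lambda>_. 0)) p = foldr strips ms (delta (\<lambda>_. 0)) p"
      using strips_0[OF Cons.prems] by simp
    with 1 Cons.IH[OF Cons.prems] show ?thesis by (simp del: foldr_filter foldr.simps)
  next
    case 2
    then have "foldr strips (m # ms) (delta (\<lambda>_. 0)) p = down (foldr strips ms (delta (\<lambda>_. 0))) p"
      using strips_1[OF Cons.prems] by simp
    also have "\<dots> = down (foldr strips (filter (\<lambda>m. 2 \<le> m) ms) ((down ^^ count_list ms 1) (delta (\<lambda>_. 0)))) p"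
      by (rule down_cong[OF Cons.prems]) (rule Cons.IH)
    also have "\<dots> = foldr strips (filter (\<lambda>m. 2 \<le> m) ms) (down ((down ^^ count_list ms 1) (delta (\<lambda>_. 0)))) p"
      by (rule foldr_strips_down[OF Cons.prems, symmetric])
    finally show ?thesis using 2 by (simp del: foldr_filter foldr.simps)
  next
    case 3
    have "strips m (foldr strips ms (delta (\<lambda>_. 0))) p =
        strips m (foldr strips (filter (\<lambda>m. 2 \<le> m) ms) ((down ^^ count_list ms 1) (delta (\<lambda>_. 0)))) p"
      by (rule strips_cong[OF Cons.prems Cons.IH])
    with 3 show ?thesis by (simp del: foldr_filter)
  qed
qed simp

text \<open>The value of \<open>\<delta>\<close> is tied to the j cells that remain at the end.
  Every intermediate shape is at least as large and its first row is no longer than b, so the same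
  \<open>\<delta>\<close> serves for each strip.\<close>

lemma foldr_strips_bound:
  assumes b: "1 \<le> b" and d: "real b \<le> \<delta> * real j" "\<delta> \<le> 2" "0 \<le> \<delta>"
  shows "young p \<Longrightarrow> p 0 \<le> b \<Longrightarrow> csize p = j + sum_list ms \<Longrightarrow>
    foldr strips ms ((down ^^ j) (delta (\<lambda>_. 0))) p \<le> tableau_count p * prod_list (map (\<lambda>m. 1 / fact m + 12 ^ m * \<delta>) ms)"
proof (induction ms arbitrary: p)
  case Nil
  then show ?case by (simp add: tableau_count_eq)
next
  case (Cons m ms)
  let ?W = "prod_list (map (\<lambda>m. 1 / fact m + 12 ^ m * \<delta>) ms)"
  have "foldr strips (m # ms) ((down ^^ j) (delta (\<lambda>_. 0))) p \<le> strips m (\<lambda>q. ?W * tableau_count q) p"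
    unfolding foldr.simps comp_apply
  proof (rule strips_mono[OF Cons.prems(1)])
    fix q assume q: "young q" "hstrip q p" "csize p = csize q + m"
    then show "foldr strips ms ((down ^^ j) (delta (\<lambda>_. 0))) q \<le> ?W * tableau_count q"
      using Cons.IH[of q] Cons.prems hstrip_le[OF q(2), of 0] by (simp add: mult.commute)
  qed
  also have "\<dots> \<le> ?W * (tableau_count p * (1 / fact m + 12 ^ m * \<delta>))"
    unfolding strips_cmult
  proof (rule mult_left_mono[OF strips_tableau_count_bound])
    have "\<delta> * real j \<le> \<delta> * real (csize p)" using Cons.prems d by (intro mult_left_mono) auto
    then show "real b \<le> \<delta> * real (csize p)" using d by linarith
    show "0 \<le> ?W" using d by (intro prod_list_nonneg) auto
  qed (use Cons.prems b d in auto)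
  finally show ?case by (simp add: mult_ac)
qed

lemma foldr_strips_le_tableau_count:
  "young p \<Longrightarrow> csize p = j + sum_list ms \<Longrightarrow> foldr strips ms ((down ^^ j) (delta (\<lambda>_. 0))) p \<le> tableau_count p"
proof (induction ms arbitrary: p)
  case Nil
  then show ?case by (simp add: tableau_count_eq)
next
  case (Cons m ms)
  have "foldr strips (m # ms) ((down ^^ j) (delta (\<lambda>_. 0))) p \<le> strips m tableau_count p"
    unfolding foldr.simps comp_apply
  proof (rule strips_mono[OF Cons.prems(1)])
    fix q assume "young q" "csize p = csize q + m"
    then show "foldr strips ms ((down ^^ j) (delta (\<lambda>_. 0))) q \<le> tableau_count q"
      using Cons.IH[of q] Cons.prems(2) by simp
  qed
  then show ?case using strips_tableau_count_le[OF Cons.prems(1), of m] by simp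
qed

lemma prod_list_filter_big:
  fixes w :: "nat \<Rightarrow> real" assumes "w 0 = 1" "w 1 = 1"
  shows "prod_list (map w (filter (\<lambda>m. 2 \<le> m) ms)) = prod_list (map w ms)"
proof (induction ms)
  case (Cons m ms)
  then show ?case using assms by (cases "2 \<le> m") (auto simp: not_le less_2_cases_iff)
qed simp

text \<open>Only the two extreme terms of the expanded product are kept. For the empty list the left
  side would be 2, hence the restriction.\<close>

lemma prod_list_add_ge:
  fixes a c :: "nat \<Rightarrow> real"
  assumes "\<And>m. 0 \<le> a m" "\<And>m. 0 \<le> c m"
  shows "ms \<noteq> [] \<Longrightarrow> prod_list (map a ms) + prod_list (map c ms) \<le> prod_list (map (\<lambda>m. a m + c m) ms)"
proof (induction ms rule: list_nonempty_induct)
  case (cons m ms)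
  let ?A = "prod_list (map a ms)" and ?C = "prod_list (map c ms)"
  have "0 \<le> ?A" "0 \<le> ?C" using assms by (auto intro!: prod_list_nonneg)
  then have "0 \<le> a m * ?C" "0 \<le> c m * ?A" using assms by auto
  then have "a m * ?A + c m * ?C \<le> (a m + c m) * (?A + ?C)" by (simp add: algebra_simps)
  also have "\<dots> \<le> (a m + c m) * prod_list (map (\<lambda>m. a m + c m) ms)"
    using cons assms by (intro mult_left_mono) (auto intro: add_nonneg_nonneg)
  finally show ?case by simp
qed simp

lemma sum_list_split_ones:
  "sum_list ms = count_list ms 1 + sum_list (filter (\<lambda>m. 2 \<le> m) ms)" for ms :: "nat list"
proof (induction ms)
  case (Cons m ms)
  then show ?case by (cases "2 \<le> m") (auto simp: not_le less_2_cases_iff)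
qed simp

text \<open>Parts at least two are stripped first, so that most of the shape is still there when the
  estimate for a single strip is applied; the second summand accounts for the case where they use
  up more than half of the shape.\<close>

lemma foldr_strips_delta_bound:
  assumes p: "young p" and b: "1 \<le> b" "p 0 \<le> b" "b \<le> csize p" and ms: "sum_list ms = csize p"
  defines "\<delta> \<equiv> 2 * real b / real (csize p)"
  shows "foldr strips ms (delta (\<lambda>_. 0)) p \<le> tableau_count p *
    (prod_list (map (\<lambda>m. 1 / fact m + (if 2 \<le> m then 12 ^ m * \<delta> else 0)) ms) +
     (1 / 2 ^ csize p) * (prod_list (map (\<lambda>m. 1 / fact m + (if 2 \<le> m then 4 ^ m else 0)) ms)
        - prod_list (map (\<lambda>m. 1 / fact m) ms)))"
proof -
  define K where "K = csize p"
  define bs where "bs = filter (\<lambda>m. 2 \<le> m) ms"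
  define j where "j = count_list ms 1"
  have sum: "K = j + sum_list bs"
    unfolding K_def j_def bs_def ms[symmetric] by (rule sum_list_split_ones)
  let ?f = "foldr strips bs ((down ^^ j) (delta (\<lambda>_. 0))) p"
  let ?w1 = "\<lambda>m::nat. 1 / fact m + (if 2 \<le> m then 12 ^ m * \<delta> else 0)"
  let ?w2 = "\<lambda>m::nat. 1 / fact m + (if 2 \<le> m then 4 ^ m else 0) :: real"
  let ?w3 = "\<lambda>m::nat. 1 / fact m :: real"
  have K: "0 < K" using b K_def by simp
  have d: "0 \<le> \<delta>" "\<delta> \<le> 2" unfolding \<delta>_def using b by (auto simp: divide_simps)
  have eq: "prod_list (map ?w1 ms) = prod_list (map ?w1 bs)" "prod_list (map ?w2 ms) = prod_list (map ?w2 bs)"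
    "prod_list (map ?w3 ms) = prod_list (map ?w3 bs)"
    unfolding bs_def by (subst prod_list_filter_big; simp)+
  have "prod_list (map ?w1 bs) = prod_list (map (\<lambda>m. 1 / fact m + 12 ^ m * \<delta>) bs)"
    by (rule arg_cong[of _ _ prod_list], rule map_cong) (auto simp: bs_def)
  moreover have w2: "prod_list (map ?w2 bs) = prod_list (map (\<lambda>m. 1 / fact m + 4 ^ m) bs)"
    by (rule arg_cong[of _ _ prod_list], rule map_cong) (auto simp: bs_def)
  moreover have "0 \<le> prod_list (map ?w1 bs)" using d by (intro prod_list_nonneg) auto
  moreover have ge: "0 \<le> prod_list (map ?w2 bs) - prod_list (map ?w3 bs)"
  proof (cases "bs = []")
    case False
    have "0 \<le> prod_list (map (\<lambda>m. 4 ^ m :: real) bs)" by (intro prod_list_nonneg) auto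
    then show ?thesis unfolding w2 using prod_list_add_ge[of ?w3 "\<lambda>m. 4 ^ m", OF _ _ False] by simp
  qed simp
  moreover have "?f \<le> tableau_count p * prod_list (map (\<lambda>m. 1 / fact m + 12 ^ m * \<delta>) bs)" if "2 * sum_list bs \<le> K"
  proof (rule foldr_strips_bound[OF b(1) _ d(2,1) p b(2)])
    \<comment> \<open>Here at least half of the cells are single-cell strips, so j \<ge> K/2; this
      is the source of the factor 2 in \<open>\<delta>\<close>.\<close>
    have "real b * real K \<le> real b * (2 * real j)" using that sum by (intro mult_left_mono) auto
    then show "real b \<le> \<delta> * real j" using K by (simp add: \<delta>_def K_def[symmetric] field_simps)
  qed (use sum K_def in simp)
  moreover have "?f \<le> tableau_count p" by (rule foldr_strips_le_tableau_count[OF p]) (use sum K_def in simp)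
  \<comment> \<open>The weights 4^m of the large parts multiply to 4 to the power of their sum. When
    that sum exceeds K/2, this is at least 2^K.\<close>
  moreover have "1 \<le> (1 / 2 ^ K) * (prod_list (map ?w2 bs) - prod_list (map ?w3 bs))" if "\<not> 2 * sum_list bs \<le> K"
  proof -
    have "bs \<noteq> []" using that by auto
    then have "prod_list (map (\<lambda>m. 4 ^ m) bs) \<le> prod_list (map ?w2 bs) - prod_list (map ?w3 bs)"
      unfolding w2 using prod_list_add_ge[of ?w3 "\<lambda>m. 4 ^ m" bs] by simp
    moreover have "prod_list (map (\<lambda>m. 4 ^ m) bs) = (4::real) ^ sum_list bs"
      by (induction bs) (auto simp: power_add)
    moreover have "(4::real) ^ sum_list bs = 2 ^ (2 * sum_list bs)" by (simp add: power_mult)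
    moreover have "(2::real) ^ K \<le> 2 ^ (2 * sum_list bs)" using that by (intro power_increasing) auto
    ultimately have "2 ^ K \<le> prod_list (map ?w2 bs) - prod_list (map ?w3 bs)" by linarith
    then show ?thesis by simp
  qed
  ultimately have "?f \<le> tableau_count p * (prod_list (map ?w1 bs) +
     (1 / 2 ^ K) * (prod_list (map ?w2 bs) - prod_list (map ?w3 bs)))"
  proof (cases "2 * sum_list bs \<le> K")
    case True
    have "0 \<le> (1 / 2 ^ K) * (prod_list (map ?w2 bs) - prod_list (map ?w3 bs))"
      using ge by simp
    then have "tableau_count p * prod_list (map ?w1 bs) \<le> tableau_count p * (prod_list (map ?w1 bs) +
     (1 / 2 ^ K) * (prod_list (map ?w2 bs) - prod_list (map ?w3 bs)))"
      using tableau_count_pos[OF p] by (intro mult_left_mono) auto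
    moreover have "?f \<le> tableau_count p * prod_list (map ?w1 bs)"
      using True \<open>2 * sum_list bs \<le> K \<Longrightarrow> _\<close> \<open>prod_list (map ?w1 bs) = _\<close> by metis
    ultimately show ?thesis by (rule order_trans[rotated])
  next
    case False
    then have "1 \<le> prod_list (map ?w1 bs) +
     (1 / 2 ^ K) * (prod_list (map ?w2 bs) - prod_list (map ?w3 bs))"
      using \<open>\<not> 2 * sum_list bs \<le> K \<Longrightarrow> _\<close> \<open>0 \<le> prod_list (map ?w1 bs)\<close> by (intro add_increasing) simp_all
    then have "tableau_count p * 1 \<le> tableau_count p * (prod_list (map ?w1 bs) +
     (1 / 2 ^ K) * (prod_list (map ?w2 bs) - prod_list (map ?w3 bs)))"
      using tableau_count_pos[OF p] by (rule mult_left_mono[OF _ less_imp_le])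
    moreover have "?f \<le> tableau_count p * 1" using \<open>?f \<le> tableau_count p\<close> by simp
    ultimately show ?thesis by (rule order_trans[rotated])
  qed
  then show ?thesis
    unfolding foldr_strips_reorder[OF p, of ms] eq K_def[symmetric] bs_def[symmetric] j_def[symmetric] .
qed

section \<open>Generating functions\<close>

fun expand :: "real list \<Rightarrow> nat \<Rightarrow> (nat list \<Rightarrow> real) \<Rightarrow> real" where
  "expand [] k F = (if k = 0 then F [] else 0)"
| "expand (y # ys) k F = (\<Sum>m\<le>k. y ^ m * expand ys (k - m) (\<lambda>ms. F (m # ms)))"

lemma expand_sum: "expand ys k (\<lambda>ms. \<Sum>i\<in>I. F i ms) = (\<Sum>i\<in>I. expand ys k (F i))"
proof (induction ys arbitrary: k F)
  case (Cons y ys)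
  have "expand (y # ys) k (\<lambda>ms. \<Sum>i\<in>I. F i ms) =
      (\<Sum>m\<le>k. \<Sum>i\<in>I. y ^ m * expand ys (k - m) (\<lambda>ms. F i (m # ms)))"
    by (simp add: Cons.IH sum_distrib_left)
  also have "\<dots> = (\<Sum>i\<in>I. expand (y # ys) k (F i))"
    by (subst sum.swap) simp
  finally show ?case .
qed simp

lemma expand_add: "expand ys k (\<lambda>ms. F ms + G ms) = expand ys k F + expand ys k G"
  by (induction ys arbitrary: k F G) (auto simp: sum.distrib distrib_left)

lemma expand_cmult: "expand ys k (\<lambda>ms. c * F ms) = c * expand ys k F"
  by (induction ys arbitrary: k F) (auto simp: sum_distrib_left mult_ac)

lemma expand_diff: "expand ys k (\<lambda>ms. F ms - G ms) = expand ys k F - expand ys k G"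
  using expand_add[of ys k F "\<lambda>ms. (-1) * G ms"] expand_cmult[of ys k "-1" G] by simp

lemma expand_mono:
  "(\<And>y. y \<in> set ys \<Longrightarrow> 0 \<le> y) \<Longrightarrow> (\<And>ms. sum_list ms = k \<Longrightarrow> F ms \<le> G ms) \<Longrightarrow>
    expand ys k F \<le> expand ys k G"
  by (induction ys arbitrary: k F G) (auto intro!: sum_mono mult_left_mono)

lemma strip_series_eq_expand:
  "young p \<Longrightarrow> strip_series ys p = expand ys (csize p) (\<lambda>ms. foldr strips ms (delta (\<lambda>_. 0)) p)"
proof (induction ys arbitrary: p)
  case Nil
  then show ?case by (auto simp: csize_eq_0_iff delta_def)
next
  case (Cons y ys)
  let ?e = "\<lambda>ms q. foldr strips ms (delta (\<lambda>_. 0)) q"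
  have "strip_series (y # ys) p = (\<Sum>q | hstrip q p. y ^ (csize p - csize q) * strip_series ys q)" by simp
  also have "\<dots> = (\<Sum>m\<le>csize p. \<Sum>q | q \<in> {q. hstrip q p} \<and> csize p - csize q = m. y ^ (csize p - csize q) * strip_series ys q)"
    using Cons.prems by (intro sum.group[symmetric]) auto
  also have "\<dots> = (\<Sum>m\<le>csize p. y ^ m * (\<Sum>q | hstrip q p \<and> csize p = csize q + m. strip_series ys q))"
    unfolding sum_distrib_left using hstrip_csize[OF Cons.prems]
    by (intro sum.cong refl) (auto simp: add.commute)
  also have "\<dots> = (\<Sum>m\<le>csize p. y ^ m * expand ys (csize p - m) (\<lambda>ms. ?e (m # ms) p))"
  proof (intro sum.cong refl arg_cong[of _ _ "(*) _"])
    fix m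
    have "(\<Sum>q | hstrip q p \<and> csize p = csize q + m. strip_series ys q) =
        (\<Sum>q | hstrip q p \<and> csize p = csize q + m. expand ys (csize p - m) (\<lambda>ms. ?e ms q))"
      using Cons.IH young_hstrip[OF Cons.prems] by (intro sum.cong) auto
    then show "(\<Sum>q | hstrip q p \<and> csize p = csize q + m. strip_series ys q) = expand ys (csize p - m) (\<lambda>ms. ?e (m # ms) p)"
      unfolding foldr.simps comp_apply strips_def expand_sum .
  qed
  finally show ?case by simp
qed

section \<open>Coefficients of perturbed exponentials\<close>

lemma expand_prod_eq_fps:
  "expand ys k (\<lambda>ms. prod_list (map w ms)) = fps_nth (prod_list (map (\<lambda>y. Abs_fps (\<lambda>m. w m * y ^ m)) ys)) k"
  by (induction ys arbitrary: k)
    (auto simp: expand_cmult fps_mult_nth atLeast0AtMost mult_ac intro!: sum.cong)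

lemma prod_list_fps_exp:
  fixes ys :: "real list"
  shows "prod_list (map (\<lambda>y. Abs_fps (\<lambda>m. 1 / fact m * y ^ m)) ys) = fps_exp (sum_list ys)"
proof (induction ys)
  case (Cons y ys)
  have "Abs_fps (\<lambda>m. 1 / fact m * y ^ m) = fps_exp y" by (simp add: fps_eq_iff)
  then show ?case using Cons by (simp add: fps_exp_add_mult)
qed simp

text \<open>For a series T with nonnegative coefficients, e^(y z) + T is at most e^(y z) (1 + T)
  coefficientwise, since the exponential has constant term 1. The exponentials can then be merged
  into a single one.\<close>

lemma prod_list_fps_le:
  fixes th :: "nat \<Rightarrow> real"
  assumes th: "\<And>m. 0 \<le> th m"
  shows "(\<And>y. y \<in> set ys \<Longrightarrow> 0 \<le> y) \<Longrightarrow>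
    0 \<le> fps_nth (prod_list (map (\<lambda>y. Abs_fps (\<lambda>m. (1 / fact m + th m) * y ^ m)) ys)) k \<and>
    0 \<le> fps_nth (prod_list (map (\<lambda>y. 1 + Abs_fps (\<lambda>m. th m * y ^ m)) ys)) k \<and>
    fps_nth (prod_list (map (\<lambda>y. Abs_fps (\<lambda>m. (1 / fact m + th m) * y ^ m)) ys)) k \<le>
    fps_nth (fps_exp (sum_list ys) * prod_list (map (\<lambda>y. 1 + Abs_fps (\<lambda>m. th m * y ^ m)) ys)) k"
proof (induction ys arbitrary: k)
  case (Cons y ys)
  let ?A = "prod_list (map (\<lambda>y. Abs_fps (\<lambda>m. (1 / fact m + th m) * y ^ m)) ys)"
  let ?G = "prod_list (map (\<lambda>y. 1 + Abs_fps (\<lambda>m. th m * y ^ m)) ys)"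
  let ?a = "Abs_fps (\<lambda>m. (1 / fact m + th m) * y ^ m)" and ?t = "1 + Abs_fps (\<lambda>m. th m * y ^ m)"
  have y: "0 \<le> y" using Cons.prems by simp
  have s: "0 \<le> sum_list ys" using Cons.prems by (intro sum_list_nonneg) auto
  have IH: "0 \<le> fps_nth ?A i" "0 \<le> fps_nth ?G i" "fps_nth ?A i \<le> fps_nth (fps_exp (sum_list ys) * ?G) i" for i
    using Cons by auto
  have t: "0 \<le> fps_nth ?t i" for i using th y by simp
  have a: "0 \<le> fps_nth ?a i" for i using th y by simp
  have at: "fps_nth ?a i \<le> fps_nth (fps_exp y * ?t) i" for i
  proof -
    have "fps_nth ?a i = fps_nth (fps_exp y) i + fps_nth (fps_exp y) 0 * (th i * y ^ i)"
      by (simp add: algebra_simps)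
    also have "fps_nth (fps_exp y) 0 * (th i * y ^ i) \<le> fps_nth (fps_exp y * Abs_fps (\<lambda>m. th m * y ^ m)) i"
      unfolding fps_mult_nth using th y
      by (intro order_trans[OF _ member_le_sum[of 0]]) auto
    finally show ?thesis by (simp add: algebra_simps)
  qed
  have "fps_nth (?a * ?A) k \<le> fps_nth ((fps_exp y * ?t) * (fps_exp (sum_list ys) * ?G)) k"
    unfolding fps_mult_nth[of ?a] fps_mult_nth[of "fps_exp y * ?t"]
    using IH a at order_trans[OF a at] by (intro sum_mono mult_mono) auto
  also have "(fps_exp y * ?t) * (fps_exp (sum_list ys) * ?G) = fps_exp (sum_list (y # ys)) * (?t * ?G)"
    by (simp add: fps_exp_add_mult mult_ac)
  finally have "fps_nth (?a * ?A) k \<le> fps_nth (fps_exp (sum_list (y # ys)) * (?t * ?G)) k" .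
  moreover have "0 \<le> fps_nth (?a * ?A) k" unfolding fps_mult_nth using IH a by (intro sum_nonneg mult_nonneg_nonneg)
  moreover have "0 \<le> fps_nth (?t * ?G) k" unfolding fps_mult_nth using IH t by (intro sum_nonneg mult_nonneg_nonneg)
  ultimately show ?case by simp
qed (auto simp: fps_one_nth)

text \<open>With nonnegative coefficients, truncating the product only drops mixed terms. Truncated
  sums take the place of evaluating the series, so no convergence is involved.\<close>

lemma truncated_eval_mult:
  fixes f g :: "real fps"
  assumes "\<And>i. 0 \<le> fps_nth f i" "\<And>i. 0 \<le> fps_nth g i" "0 \<le> z"
  shows "(\<Sum>j\<le>K. fps_nth (f * g) j * z ^ j) \<le> (\<Sum>j\<le>K. fps_nth f j * z ^ j) * (\<Sum>j\<le>K. fps_nth g j * z ^ j)"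
proof -
  have "(\<Sum>j\<le>K. fps_nth (f * g) j * z ^ j) =
      (\<Sum>j\<le>K. \<Sum>i\<le>j. fps_nth f i * z ^ i * (fps_nth g (j - i) * z ^ (j - i)))"
    unfolding fps_mult_nth atLeast0AtMost sum_distrib_right
    by (intro sum.cong refl) (auto simp: mult_ac power_add[symmetric])
  also have "\<dots> = (\<Sum>(i, j) | i + j \<le> K. fps_nth f i * z ^ i * (fps_nth g j * z ^ j))"
    by (rule sum.triangle_reindex_eq[symmetric])
  also have "\<dots> \<le> (\<Sum>(i, j)\<in>{..K} \<times> {..K}. fps_nth f i * z ^ i * (fps_nth g j * z ^ j))"
    using assms by (intro sum_mono2) auto
  also have "\<dots> = (\<Sum>j\<le>K. fps_nth f j * z ^ j) * (\<Sum>j\<le>K. fps_nth g j * z ^ j)"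
    by (simp add: sum_product sum.cartesian_product)
  finally show ?thesis .
qed

lemma truncated_eval_prod_list:
  fixes f :: "'a \<Rightarrow> real fps"
  assumes z: "0 \<le> z"
  shows "(\<And>y i. y \<in> set ys \<Longrightarrow> 0 \<le> fps_nth (f y) i) \<Longrightarrow>
    (\<forall>i. 0 \<le> fps_nth (prod_list (map f ys)) i) \<and>
    (\<Sum>j\<le>K. fps_nth (prod_list (map f ys)) j * z ^ j) \<le> prod_list (map (\<lambda>y. \<Sum>j\<le>K. fps_nth (f y) j * z ^ j) ys)"
proof (induction ys)
  case Nil
  then show ?case by (simp add: fps_one_nth if_distrib[of "\<lambda>x. x * _"] sum.delta cong: if_cong)
next
  case (Cons y ys)
  let ?P = "prod_list (map f ys)"
  have P: "\<And>i. 0 \<le> fps_nth ?P i" using Cons by auto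
  have fy: "\<And>i. 0 \<le> fps_nth (f y) i" using Cons.prems by simp
  have "(\<Sum>j\<le>K. fps_nth (f y * ?P) j * z ^ j) \<le> (\<Sum>j\<le>K. fps_nth (f y) j * z ^ j) * (\<Sum>j\<le>K. fps_nth ?P j * z ^ j)"
    by (rule truncated_eval_mult[OF fy P z])
  also have "\<dots> \<le> (\<Sum>j\<le>K. fps_nth (f y) j * z ^ j) * prod_list (map (\<lambda>y. \<Sum>j\<le>K. fps_nth (f y) j * z ^ j) ys)"
    using Cons fy z by (intro mult_left_mono sum_nonneg) auto
  finally have "(\<Sum>j\<le>K. fps_nth (f y * ?P) j * z ^ j) \<le> \<dots>" .
  moreover have "0 \<le> fps_nth (f y * ?P) i" for i
    unfolding fps_mult_nth using fy P by (intro sum_nonneg mult_nonneg_nonneg)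
  ultimately show ?case by simp
qed

text \<open>Uses K!/(K-j)! \<le> K^j. The point K/Y is the saddle point, where e^(Y z) / z^K is
  smallest.\<close>

lemma fps_exp_mult_nth_le:
  fixes G :: "real fps"
  assumes Y: "0 < Y" and G: "\<And>i. 0 \<le> fps_nth G i"
  shows "fps_nth (fps_exp Y * G) K \<le> Y ^ K / fact K * (\<Sum>j\<le>K. fps_nth G j * (real K / Y) ^ j)"
proof -
  have "fps_nth (fps_exp Y * G) K = fps_nth (G * fps_exp Y) K" by (simp add: mult.commute)
  also have "\<dots> = (\<Sum>j\<le>K. fps_nth G j * (Y ^ (K - j) / fact (K - j)))"
    by (simp add: fps_mult_nth atLeast0AtMost)
  also have "\<dots> \<le> (\<Sum>j\<le>K. Y ^ K / fact K * (fps_nth G j * (real K / Y) ^ j))"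
  proof (rule sum_mono)
    fix j assume "j \<in> {..K}"
    then have j: "j \<le> K" by simp
    have "(fact K :: nat) div fact (K - j) \<le> K ^ j"
      using fact_div_fact_le_pow[OF j] .
    moreover have "(fact (K - j) :: nat) dvd fact K" by (rule fact_dvd) simp
    ultimately have "real (fact K) / real (fact (K - j)) \<le> real (K ^ j)"
      by (metis of_nat_le_iff real_of_nat_div)
    then have "1 / fact (K - j) \<le> real K ^ j / (fact K :: real)"
      by (simp add: field_simps)
    then have "Y ^ (K - j) * (1 / fact (K - j)) \<le> Y ^ (K - j) * (real K ^ j / fact K)"
      using Y by (intro mult_left_mono) auto
    also have "\<dots> = Y ^ K / fact K * (real K / Y) ^ j"
      using Y j by (simp add: power_divide power_diff)
    finally have "fps_nth G j * (Y ^ (K - j) * (1 / fact (K - j))) \<le> fps_nth G j * (Y ^ K / fact K * (real K / Y) ^ j)"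
      using G[of j] by (rule mult_left_mono)
    then show "fps_nth G j * (Y ^ (K - j) / fact (K - j)) \<le> Y ^ K / fact K * (fps_nth G j * (real K / Y) ^ j)"
      by (simp add: mult_ac)
  qed
  finally show ?thesis by (simp add: sum_distrib_left)
qed

text \<open>The perturbation enters only through its truncated values at the saddle point; 1 + t
  \<le> e^t turns the product over ys into the exponential of a sum.\<close>

lemma expand_perturbed_exp_le:
  fixes th :: "nat \<Rightarrow> real"
  assumes th: "\<And>m. 0 \<le> th m" and ys: "\<And>y. y \<in> set ys \<Longrightarrow> 0 \<le> y" and Y: "0 < sum_list ys"
  shows "expand ys K (\<lambda>ms. prod_list (map (\<lambda>m. 1 / fact m + th m) ms)) \<le>
    sum_list ys ^ K / fact K * exp (\<Sum>y\<leftarrow>ys. \<Sum>m\<le>K. th m * (y * (real K / sum_list ys)) ^ m)"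
proof -
  let ?Y = "sum_list ys" and ?z = "real K / sum_list ys"
  let ?f = "\<lambda>y. 1 + Abs_fps (\<lambda>m. th m * y ^ m)"
  have f: "0 \<le> fps_nth (?f y) i" if "y \<in> set ys" for y i using th ys[OF that] by simp
  have z: "0 \<le> ?z" using Y by simp
  note te = truncated_eval_prod_list[OF z, of ys ?f K, OF f]
  have "expand ys K (\<lambda>ms. prod_list (map (\<lambda>m. 1 / fact m + th m) ms)) \<le> fps_nth (fps_exp ?Y * prod_list (map ?f ys)) K"
    unfolding expand_prod_eq_fps using prod_list_fps_le[of th ys K, OF th ys] by blast
  also have "\<dots> \<le> ?Y ^ K / fact K * (\<Sum>j\<le>K. fps_nth (prod_list (map ?f ys)) j * ?z ^ j)"
    using te by (intro fps_exp_mult_nth_le Y) blast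
  also have "\<dots> \<le> ?Y ^ K / fact K * prod_list (map (\<lambda>y. \<Sum>j\<le>K. fps_nth (?f y) j * ?z ^ j) ys)"
    using te Y by (intro mult_left_mono) auto
  also have "\<dots> \<le> ?Y ^ K / fact K * exp (\<Sum>y\<leftarrow>ys. \<Sum>m\<le>K. th m * (y * ?z) ^ m)"
  proof -
    have e: "(\<Sum>j\<le>K. fps_nth (?f y) j * z ^ j) = 1 + (\<Sum>m\<le>K. th m * (y * z) ^ m)" for y z
    proof -
      have "fps_nth (?f y) j * z ^ j = (if j = 0 then 1 else 0) + th j * (y * z) ^ j" for j
        by (simp add: power_mult_distrib algebra_simps)
      then show ?thesis by (simp add: sum.distrib)
    qed
    have pe: "0 \<le> prod_list (map (\<lambda>y. 1 + s y) l) \<and> prod_list (map (\<lambda>y. 1 + s y) l) \<le> exp (\<Sum>y\<leftarrow>l. s y)"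
      if "\<And>y. y \<in> set l \<Longrightarrow> 0 \<le> s y" for s :: "real \<Rightarrow> real" and l
      using that
    proof (induction l)
      case (Cons y l)
      then have "(1 + s y) * prod_list (map (\<lambda>y. 1 + s y) l) \<le> exp (s y) * exp (\<Sum>y\<leftarrow>l. s y)"
        by (intro mult_mono exp_ge_add_one_self) auto
      then show ?case using Cons by (simp add: exp_add)
    qed simp
    have "0 \<le> (\<Sum>m\<le>K. th m * (y * ?z) ^ m)" if "y \<in> set ys" for y
      by (intro sum_nonneg mult_nonneg_nonneg zero_le_power th ys[OF that] z)
    then have "prod_list (map (\<lambda>y. \<Sum>j\<le>K. fps_nth (?f y) j * ?z ^ j) ys) \<le> exp (\<Sum>y\<leftarrow>ys. \<Sum>m\<le>K. th m * (y * ?z) ^ m)"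
      unfolding e by (rule conjunct2[OF pe])
    then show ?thesis using Y by (intro mult_left_mono) auto
  qed
  finally show ?thesis .
qed

section \<open>Size of the exponent\<close>

lemma geometric_tail_le:
  fixes x :: real assumes "0 \<le> x" "x \<le> 1 / 2"
  shows "(\<Sum>m\<le>K. if 2 \<le> m then x ^ m else 0) \<le> 2 * x\<^sup>2"
proof -
  have "(\<Sum>m\<le>K. if 2 \<le> m then x ^ m else 0) = (\<Sum>m\<in>{2..K}. x ^ m)"
    by (subst sum.inter_filter[symmetric]) (auto intro!: sum.cong)
  also have "\<dots> \<le> (\<Sum>m\<in>{2..K + 2}. x ^ m)" using assms by (intro sum_mono2) auto
  also have "\<dots> = (\<Sum>m\<le>K. x ^ (m + 2))"
    by (rule sum.reindex_bij_witness[of _ "\<lambda>m. m + 2" "\<lambda>m. m - 2"]) (auto simp del: add_2_eq_Suc')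
  also have "\<dots> = x\<^sup>2 * (\<Sum>m\<le>K. x ^ m)" unfolding power_add sum_distrib_left by (simp add: mult.commute)
  also have "\<dots> \<le> x\<^sup>2 * 2"
  proof (rule mult_left_mono)
    show "(\<Sum>m\<le>K. x ^ m) \<le> 2"
    proof (induction K)
      case (Suc K)
      have "(\<Sum>m\<le>Suc K. x ^ m) = 1 + x * (\<Sum>m\<le>K. x ^ m)"
        by (subst sum.atMost_Suc_shift) (simp add: sum_distrib_left)
      also have "x * (\<Sum>m\<le>K. x ^ m) \<le> 1 / 2 * 2" using Suc assms by (intro mult_mono sum_nonneg) auto
      finally show ?case by simp
    qed simp
  qed simp
  finally show ?thesis by (simp add: mult.commute)
qed

lemma sum_list_square_le:
  "(\<And>y. y \<in> set ys \<Longrightarrow> 0 \<le> y \<and> y \<le> M) \<Longrightarrow> (\<Sum>y\<leftarrow>ys. y\<^sup>2) \<le> M * sum_list ys" for M :: real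
  by (induction ys) (auto simp: power2_eq_square distrib_left intro!: add_mono mult_right_mono)

text \<open>Since the perturbation starts in degree 2, each y contributes O(y^2), and the sum of
  squares is at most M times the sum. This gains one factor K M / Y, which the hypothesis makes
  small enough for the geometric series.\<close>

lemma perturbation_exponent_le:
  fixes D c M :: real
  assumes D: "0 \<le> D" "0 \<le> c" and ys: "\<And>y. y \<in> set ys \<Longrightarrow> 0 \<le> y \<and> y \<le> M" and Y: "0 < sum_list ys"
    and s: "D * (real K * M / sum_list ys) \<le> 1 / 2"
  shows "(\<Sum>y\<leftarrow>ys. \<Sum>m\<le>K. (if 2 \<le> m then D ^ m * c else 0) * (y * (real K / sum_list ys)) ^ m)
    \<le> 2 * c * D\<^sup>2 * (real K * (real K * M / sum_list ys))"
proof -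
  define z where "z = real K / sum_list ys"
  have z: "0 \<le> z" using Y by (simp add: z_def)
  have "(\<Sum>m\<le>K. (if 2 \<le> m then D ^ m * c else 0) * (y * z) ^ m) \<le> 2 * c * D\<^sup>2 * z\<^sup>2 * y\<^sup>2" if y: "y \<in> set ys" for y
  proof -
    have "D * (y * z) \<le> D * (M * z)" using ys[OF y] z D by (intro mult_left_mono mult_right_mono) auto
    also have "\<dots> = D * (real K * M / sum_list ys)" by (simp add: z_def mult.commute)
    finally have x: "D * (y * z) \<le> 1 / 2" using s by linarith
    have x0: "0 \<le> D * (y * z)" using ys[OF y] by (intro mult_nonneg_nonneg D z) auto
    have "(\<Sum>m\<le>K. (if 2 \<le> m then D ^ m * c else 0) * (y * z) ^ m) = c * (\<Sum>m\<le>K. if 2 \<le> m then (D * (y * z)) ^ m else 0)"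
      unfolding sum_distrib_left by (intro sum.cong refl) (simp add: power_mult_distrib)
    also have "\<dots> \<le> c * (2 * (D * (y * z))\<^sup>2)"
      using D x x0 by (intro mult_left_mono geometric_tail_le)
    finally show ?thesis by (simp add: power_mult_distrib mult_ac)
  qed
  then have "(\<Sum>y\<leftarrow>ys. \<Sum>m\<le>K. (if 2 \<le> m then D ^ m * c else 0) * (y * z) ^ m) \<le> (\<Sum>y\<leftarrow>ys. 2 * c * D\<^sup>2 * z\<^sup>2 * y\<^sup>2)"
    by (intro sum_list_mono)
  also have "\<dots> = 2 * c * D\<^sup>2 * z\<^sup>2 * (\<Sum>y\<leftarrow>ys. y\<^sup>2)" by (rule sum_list_const_mult)
  also have "\<dots> \<le> 2 * c * D\<^sup>2 * z\<^sup>2 * (M * sum_list ys)"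
    using D ys by (intro mult_left_mono sum_list_square_le) auto
  also have "\<dots> = 2 * c * D\<^sup>2 * (real K * (real K * M / sum_list ys))"
    using Y by (simp add: z_def power2_eq_square field_simps)
  finally show ?thesis unfolding z_def .
qed

text \<open>Sums the two-part estimate \<open>foldr_strips_delta_bound\<close> over all strip sizes.
  The first part costs an exponent proportional to b s; the second part must be shown to be a
  correction of the same order.\<close>

lemma strip_series_le_exp:
  assumes p: "young p" and b: "1 \<le> b" "p 0 \<le> b" "b \<le> csize p"
    and ys: "\<And>y. y \<in> set ys \<Longrightarrow> 0 \<le> y \<and> y \<le> M" and Y: "0 < sum_list ys"
  defines "s \<equiv> real (csize p) * M / sum_list ys"
  assumes s: "s \<le> 1 / 128"
  shows "strip_series ys p \<le> tableau_count p * (sum_list ys ^ csize p / fact (csize p)) * exp (704 * (real b * s))"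
proof -
  define K where "K = csize p"
  define \<delta> where "\<delta> = 2 * real b / real K"
  let ?Y = "sum_list ys"
  let ?E = "?Y ^ K / fact K"
  have K: "0 < K" using b K_def by simp
  have d: "0 \<le> \<delta>" using K by (simp add: \<delta>_def)
  have "ys \<noteq> []" using Y by auto
  then obtain y where "y \<in> set ys" by fastforce
  then have "0 \<le> M" using ys by fastforce
  then have s0: "0 \<le> s" using Y by (simp add: s_def)
  let ?th1 = "\<lambda>m::nat. if 2 \<le> m then 12 ^ m * \<delta> else 0"
  let ?th2 = "\<lambda>m::nat. if 2 \<le> m then 4 ^ m * 1 else 0 :: real"
  let ?P = "\<lambda>th ms. prod_list (map (\<lambda>m::nat. 1 / fact m + (th m :: real)) ms)"
  let ?Q = "\<lambda>ms. prod_list (map (\<lambda>m::nat. 1 / fact m :: real) ms)"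
  have ys0: "\<And>y. y \<in> set ys \<Longrightarrow> 0 \<le> y" using ys by blast
  have "strip_series ys p = expand ys K (\<lambda>ms. foldr strips ms (delta (\<lambda>_. 0)) p)"
    unfolding K_def by (rule strip_series_eq_expand[OF p])
  also have "\<dots> \<le> expand ys K (\<lambda>ms. tableau_count p * (?P ?th1 ms + (1 / 2 ^ K) * (?P ?th2 ms - ?Q ms)))"
  proof (rule expand_mono[OF ys0])
    fix ms :: "nat list" assume "sum_list ms = K"
    then show "foldr strips ms (delta (\<lambda>_. 0)) p \<le> tableau_count p * (?P ?th1 ms + (1 / 2 ^ K) * (?P ?th2 ms - ?Q ms))"
      using foldr_strips_delta_bound[OF p b, of ms] unfolding K_def \<delta>_def mult_1_right by simp
  qed
  also have "\<dots> = tableau_count p * (expand ys K (?P ?th1) + (1 / 2 ^ K) * (expand ys K (?P ?th2) - expand ys K ?Q))"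
    unfolding expand_cmult expand_add expand_diff ..
  also have "expand ys K ?Q = ?E"
    unfolding expand_prod_eq_fps prod_list_fps_exp by simp
  finally have 1: "strip_series ys p \<le> tableau_count p * (expand ys K (?P ?th1) + (1 / 2 ^ K) * (expand ys K (?P ?th2) - ?E))" .
  have E0: "0 \<le> ?E" using Y by simp
  have E1: "expand ys K (?P ?th1) \<le> ?E * exp (576 * (real b * s))"
  proof -
    have A: "expand ys K (?P ?th1) \<le> ?E * exp (\<Sum>y\<leftarrow>ys. \<Sum>m\<le>K. ?th1 m * (y * (real K / ?Y)) ^ m)"
      by (rule expand_perturbed_exp_le) (use d ys0 Y in auto)
    have "(\<Sum>y\<leftarrow>ys. \<Sum>m\<le>K. ?th1 m * (y * (real K / ?Y)) ^ m) \<le> 2 * \<delta> * 12\<^sup>2 * (real K * (real K * M / ?Y))"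
      using d s by (intro perturbation_exponent_le ys Y) (auto simp: s_def K_def)
    also have "\<dots> = 576 * (real b * s)" using K by (simp add: \<delta>_def s_def K_def[symmetric])
    finally show ?thesis by (intro order_trans[OF A] mult_left_mono[OF _ E0]) simp
  qed
  \<comment> \<open>Without the factor \<open>\<delta>\<close> the exponent is of order s K instead
    of s b, so this term is acceptable only after damping by 2^(-K).\<close>
  have E2: "expand ys K (?P ?th2) \<le> ?E * exp (32 * s * real K)"
  proof -
    have A: "expand ys K (?P ?th2) \<le> ?E * exp (\<Sum>y\<leftarrow>ys. \<Sum>m\<le>K. ?th2 m * (y * (real K / ?Y)) ^ m)"
      by (rule expand_perturbed_exp_le) (use ys0 Y in auto)
    have "(\<Sum>y\<leftarrow>ys. \<Sum>m\<le>K. ?th2 m * (y * (real K / ?Y)) ^ m) \<le> 2 * 1 * 4\<^sup>2 * (real K * (real K * M / ?Y))"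
    proof (intro perturbation_exponent_le ys Y)
      show "4 * (real K * M / ?Y) \<le> 1 / 2" using s s0 unfolding s_def K_def by linarith
    qed auto
    also have "\<dots> = 32 * s * real K" by (simp add: s_def K_def)
    finally show ?thesis by (intro order_trans[OF A] mult_left_mono[OF _ E0]) simp
  qed
  \<comment> \<open>Subtracting the unperturbed term leaves e^x - 1 \<le> x e^x with x = 32 s K,
    which retains the factor s. The assumption on s gives x \<le> K/4, and K e^(K/4) \<le> 4 e^(K/2)
    \<le> 4 * 2^K is absorbed by the damping.\<close>
  have E3: "(1 / 2 ^ K) * (exp (32 * s * real K) - 1) \<le> 128 * s"
  proof -
    let ?x = "32 * s * real K"
    have x: "0 \<le> ?x" "?x \<le> real K / 4" using s s0 mult_right_mono[of "32 * s" "1 / 4" "real K"] by auto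
    have "(1 + - ?x) * exp ?x \<le> exp (- ?x) * exp ?x" by (intro mult_right_mono exp_ge_add_one_self) simp
    then have "exp ?x - 1 \<le> ?x * exp ?x" by (simp add: exp_minus algebra_simps)
    also have "\<dots> \<le> ?x * exp (real K / 4)" using x by (intro mult_left_mono) auto
    finally have a: "exp ?x - 1 \<le> ?x * exp (real K / 4)" .
    have "exp (1 / 2 :: real) \<le> 2" using exp_bound[of "1 / 2 :: real"] by (simp add: power2_eq_square)
    then have "exp (1 / 2 :: real) ^ K \<le> 2 ^ K" by (intro power_mono) auto
    then have b2: "exp (real K / 2) \<le> 2 ^ K" by (simp add: exp_of_nat_mult[symmetric])
    have "real K \<le> 4 * exp (real K / 4)" using exp_ge_add_one_self[of "real K / 4"] by linarith
    then have "real K * exp (real K / 4) \<le> 4 * exp (real K / 4) * exp (real K / 4)" by (intro mult_right_mono) auto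
    also have "\<dots> = 4 * exp (real K / 2)" by (simp add: exp_add[symmetric])
    also have "\<dots> \<le> 4 * 2 ^ K" using b2 by simp
    finally have "32 * s * (real K * exp (real K / 4)) \<le> 32 * s * (4 * 2 ^ K)" using s0 by (intro mult_left_mono) auto
    then have "exp ?x - 1 \<le> 128 * s * 2 ^ K" using a by simp
    then show ?thesis by (simp add: field_simps)
  qed
  have "expand ys K (?P ?th1) + (1 / 2 ^ K) * (expand ys K (?P ?th2) - ?E)
      \<le> ?E * exp (576 * (real b * s)) + (1 / 2 ^ K) * (?E * exp (32 * s * real K) - ?E)"
    using E1 E2 by (intro add_mono mult_left_mono diff_mono) auto
  also have "\<dots> = ?E * (exp (576 * (real b * s)) + (1 / 2 ^ K) * (exp (32 * s * real K) - 1))"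
    by (simp add: algebra_simps)
  also have "\<dots> \<le> ?E * exp (704 * (real b * s))"
  proof (rule mult_left_mono[OF _ E0])
    \<comment> \<open>The additive error 128 s is turned into a factor 1 + 128 b s \<le> e^(128 b
      s), and 704 = 576 + 128.\<close>
    have bs: "s \<le> real b * s" using mult_right_mono[of 1 "real b" s] b s0 by simp
    have "exp (576 * (real b * s)) + (1 / 2 ^ K) * (exp (32 * s * real K) - 1) \<le> exp (576 * (real b * s)) + 128 * (real b * s)"
      using E3 bs by linarith
    also have "\<dots> \<le> exp (576 * (real b * s)) + exp (576 * (real b * s)) * (128 * (real b * s))"
      using bs s0 mult_right_mono[of 1 "exp (576 * (real b * s))" "128 * (real b * s)"] by simp
    also have "\<dots> = exp (576 * (real b * s)) * (1 + 128 * (real b * s))" by (simp add: algebra_simps)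
    also have "\<dots> \<le> exp (576 * (real b * s)) * exp (128 * (real b * s))"
      by (intro mult_left_mono exp_ge_add_one_self) simp
    also have "\<dots> = exp (704 * (real b * s))" by (simp add: exp_add[symmetric])
    finally show "exp (576 * (real b * s)) + (1 / 2 ^ K) * (exp (32 * s * real K) - 1) \<le> exp (704 * (real b * s))" .
  qed
  finally have "tableau_count p * (expand ys K (?P ?th1) + (1 / 2 ^ K) * (expand ys K (?P ?th2) - ?E)) \<le> tableau_count p * (?E * exp (704 * (real b * s)))"
    using tableau_count_pos[OF p] by (intro mult_left_mono) auto
  with 1 show ?thesis by (simp add: K_def mult.assoc)
qed

section \<open>Standard tableaux\<close>

text \<open>Formulated for an arbitrary set of cells so that deleting one cell stays within the
  definition.\<close>

definition tableaux :: "(nat \<times> nat) set \<Rightarrow> (nat \<times> nat \<Rightarrow> nat) set" where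
  "tableaux S = {T. bij_betw T S {1..card S} \<and> (\<forall>c. c \<notin> S \<longrightarrow> T c = 0)
      \<and> (\<forall>i j. (i, j) \<in> S \<longrightarrow> (i, Suc j) \<in> S \<longrightarrow> T (i, j) < T (i, Suc j))
      \<and> (\<forall>i j. (i, j) \<in> S \<longrightarrow> (Suc i, j) \<in> S \<longrightarrow> T (i, j) < T (Suc i, j))}"

lemma diagram_eq_cells: "diagram l = cells (row_fun l)"
  by (auto simp: diagram_def cells_def row_fun_def split: if_splits)

lemma SYT_skew_eq_tableaux: "SYT_skew l m = tableaux (cells (row_fun l) - cells (row_fun m))"
  by (simp add: SYT_skew_def tableaux_def skew_diagram_def diagram_eq_cells)

lemma finite_tableaux: assumes "finite S" shows "finite (tableaux S)"
proof (rule finite_subset)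
  show "tableaux S \<subseteq> {T. \<forall>c. (c \<in> S \<longrightarrow> T c \<in> {1..card S}) \<and> (c \<notin> S \<longrightarrow> T c = 0)}"
    by (auto simp: tableaux_def dest!: bij_betw_imp_surj_on)
  show "finite {T. \<forall>c. (c \<in> S \<longrightarrow> T c \<in> {1..card S}) \<and> (c \<notin> S \<longrightarrow> T c = 0)}"
    using assms by (rule finite_set_of_finite_funs) simp
qed

section \<open>Removing the largest entry\<close>

lemma card_tableaux_max_at:
  assumes S: "finite S" "(i, j) \<in> S" and out: "(i, Suc j) \<notin> S" "(Suc i, j) \<notin> S"
  shows "card {T \<in> tableaux S. T (i, j) = card S} = card (tableaux (S - {(i, j)}))"
proof -
  let ?c = "(i, j)" and ?N = "card S"
  let ?S = "S - {?c}"
  have cS: "card ?S = ?N - 1" "0 < ?N" using S by (auto simp: card_gt_0_iff)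
  have iv: "{1..?N} = insert ?N {1..?N - 1}" "?N \<notin> {1..?N - 1}" using cS by auto
  show ?thesis
  proof (rule bij_betw_same_card[OF bij_betw_byWitness[where f = "\<lambda>T. T(?c := 0)" and f' = "\<lambda>U. U(?c := ?N)"]])
    show "\<forall>T\<in>{T \<in> tableaux S. T ?c = ?N}. (T(?c := 0))(?c := ?N) = T" by auto
    show "\<forall>U\<in>tableaux ?S. (U(?c := ?N))(?c := 0) = U" by (auto simp: tableaux_def)
    show "(\<lambda>T. T(?c := 0)) ` {T \<in> tableaux S. T ?c = ?N} \<subseteq> tableaux ?S"
    proof safe
      fix T assume T: "T \<in> tableaux S" "T ?c = ?N"
      have b: "bij_betw T S {1..?N}" using T by (simp add: tableaux_def)
      have "bij_betw T (?S \<union> {?c}) ({1..?N - 1} \<union> {T ?c})"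
        using b S(2) T(2) iv(1) by (simp add: insert_absorb)
      then have "bij_betw T ?S {1..?N - 1}"
        using notIn_Un_bij_betw3[of ?c ?S T "{1..?N - 1}"] iv(2) T(2) by simp
      then have "bij_betw T ?S {1..card ?S}" using cS by simp
      then have "bij_betw (T(?c := 0)) ?S {1..card ?S}"
        by (subst bij_betw_cong[of _ _ T]) auto
      then show "T(?c := 0) \<in> tableaux ?S" using T by (auto simp: tableaux_def)
    qed
    show "(\<lambda>U. U(?c := ?N)) ` tableaux ?S \<subseteq> {T \<in> tableaux S. T ?c = ?N}"
    proof safe
      fix U assume U: "U \<in> tableaux ?S"
      have bU: "bij_betw U ?S {1..?N - 1}" using U cS by (simp add: tableaux_def)
      then have "bij_betw (U(?c := ?N)) ?S {1..?N - 1}"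
        by (subst bij_betw_cong[of _ _ U]) auto
      then have "bij_betw (U(?c := ?N)) (?S \<union> {?c}) ({1..?N - 1} \<union> {?N})"
        using notIn_Un_bij_betw[of ?c ?S "U(?c := ?N)" "{1..?N - 1}"] iv(2) by simp
      moreover have "?S \<union> {?c} = S" using S(2) by auto
      ultimately have 1: "bij_betw (U(?c := ?N)) S {1..?N}" using iv(1) by simp
      have lt: "U d < ?N" if "d \<in> ?S" for d
        using bij_betw_apply[OF bU that] cS(2) by auto
      show "U(?c := ?N) \<in> tableaux S" unfolding tableaux_def mem_Collect_eq
        by (intro conjI 1) (use U lt out S(2) in \<open>auto simp: tableaux_def\<close>)
    qed simp
  qed
qed

text \<open>The largest entry has no right or lower neighbour in the skew shape. Since q is
  antitone, such a neighbour cannot be missing by lying in q, so the cell is a corner of p.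
  Uniqueness is injectivity of T.\<close>

lemma tableau_max_cell:
  assumes p: "young p" and q: "young q" and T: "T \<in> tableaux (cells p - cells q)"
    and ne: "cells p - cells q \<noteq> {}"
  shows "\<exists>!i. i \<in> removable p \<and> q i < p i \<and> T (i, p i - 1) = card (cells p - cells q)"
proof -
  let ?S = "cells p - cells q"
  have fin: "finite ?S" using p by simp
  have b: "bij_betw T ?S {1..card ?S}" using T by (simp add: tableaux_def)
  have le: "T c \<le> card ?S" if "c \<in> ?S" for c
    using b that by (meson atLeastAtMost_iff bij_betw_apply)
  have "card ?S \<in> {1..card ?S}" using ne fin by (simp add: Suc_le_eq card_gt_0_iff)
  then have "card ?S \<in> T ` ?S" using bij_betw_imp_surj_on[OF b] by simp
  then obtain i j where c: "(i, j) \<in> ?S" "T (i, j) = card ?S" by auto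
  have "T (i, j) < T (i, Suc j)" if "(i, Suc j) \<in> ?S" using T c(1) that unfolding tableaux_def by blast
  moreover have "T (i, j) < T (Suc i, j)" if "(Suc i, j) \<in> ?S" using T c(1) that unfolding tableaux_def by blast
  ultimately have "(i, Suc j) \<notin> ?S" "(Suc i, j) \<notin> ?S"
    using c(2) le[of "(i, Suc j)"] le[of "(Suc i, j)"] by linarith+
  then have "Suc j = p i" "p (Suc i) \<le> j" "q i \<le> j"
    using c(1) young_Suc[OF q, of i] by (auto simp: cells_def)
  moreover from this have "p i - 1 = j" by simp
  ultimately have 1: "i \<in> removable p \<and> q i < p i \<and> T (i, p i - 1) = card ?S"
    using c(2) by (simp add: removable_def)
  have "i' = i" if "i' \<in> removable p \<and> q i' < p i' \<and> T (i', p i' - 1) = card ?S" for i'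
  proof -
    have "(i', p i' - 1) \<in> ?S" "(i, p i - 1) \<in> ?S" using that 1 by (auto simp: cells_def)
    then have "(i', p i' - 1) = (i, p i - 1)"
      using that 1 by (intro inj_onD[OF bij_betw_imp_inj_on[OF b]]) auto
    then show ?thesis by simp
  qed
  with 1 show ?thesis by blast
qed

text \<open>Classifying tableaux by the corner that holds the largest entry reproduces the recursion
  of \<open>chains\<close>.\<close>

lemma card_tableaux:
  "young p \<Longrightarrow> young q \<Longrightarrow> (\<And>i. q i \<le> p i) \<Longrightarrow> csize p = csize q + n \<Longrightarrow>
    real (card (tableaux (cells p - cells q))) = chains q n p"
proof (induction n arbitrary: p)
  case 0
  have "q = p" using csize_eq_imp_eq[OF 0(1,3)] 0(4) by simp
  moreover have "tableaux {} = {\<lambda>_. 0}" by (auto simp: tableaux_def bij_betw_def)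
  ultimately show ?case by simp
next
  case (Suc n)
  let ?S = "cells p - cells q"
  define R where "R = {i \<in> removable p. q i < p i}"
  have cS: "card ?S = Suc n" using card_cells_diff[OF Suc.prems(1,3)] Suc.prems(4) by simp
  then have ne: "?S \<noteq> {}" by (metis card.empty nat.distinct(1))
  have fin: "finite ?S" using Suc.prems by simp
  have finR: "finite R" using Suc.prems by (simp add: R_def)
  have "tableaux ?S = (\<Union>i\<in>R. {T \<in> tableaux ?S. T (i, p i - 1) = card ?S})"
    using ex1_implies_ex[OF tableau_max_cell[OF Suc.prems(1,2) _ ne]] by (auto simp: R_def)
  then have "card (tableaux ?S) = card (\<Union>i\<in>R. {T \<in> tableaux ?S. T (i, p i - 1) = card ?S})" by simp
  also have "\<dots> = (\<Sum>i\<in>R. card {T \<in> tableaux ?S. T (i, p i - 1) = card ?S})"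
  proof (rule card_UN_disjoint[OF finR])
    show "\<forall>i\<in>R. finite {T \<in> tableaux ?S. T (i, p i - 1) = card ?S}"
      using finite_tableaux[OF fin] by simp
    show "\<forall>i\<in>R. \<forall>j\<in>R. i \<noteq> j \<longrightarrow> {T \<in> tableaux ?S. T (i, p i - 1) = card ?S} \<inter>
      {T \<in> tableaux ?S. T (j, p j - 1) = card ?S} = {}"
      using tableau_max_cell[OF Suc.prems(1,2) _ ne] by (auto simp: R_def)
  qed
  finally have "real (card (tableaux ?S)) = (\<Sum>i\<in>R. real (card {T \<in> tableaux ?S. T (i, p i - 1) = card ?S}))"
    by simp
  also have "\<dots> = (\<Sum>i\<in>R. chains q n (dec p i))"
  proof (rule sum.cong[OF refl])
    fix i assume "i \<in> R"
    then have i: "i \<in> removable p" "q i < p i" by (auto simp: R_def)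
    have "cells (dec p i) - cells q = ?S - {(i, p i - 1)}"
      using i by (auto simp: cells_def dec_def split: if_splits)
    moreover have "card {T \<in> tableaux ?S. T (i, p i - 1) = card ?S} = card (tableaux (?S - {(i, p i - 1)}))"
      using i by (intro card_tableaux_max_at[OF fin]) (auto simp: cells_def removable_def)
    moreover have "real (card (tableaux (cells (dec p i) - cells q))) = chains q n (dec p i)"
    proof (rule Suc.IH[OF young_dec[OF Suc.prems(1) i(1)] Suc.prems(2)])
      show "q l \<le> dec p i l" for l using i Suc.prems(3)[of l] by (auto simp: dec_def)
      show "csize (dec p i) = csize q + n" using csize_dec[OF Suc.prems(1) i(1)] Suc.prems(4) by simp
    qed
    ultimately show "real (card {T \<in> tableaux ?S. T (i, p i - 1) = card ?S}) = chains q n (dec p i)" by simp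
  qed
  \<comment> \<open>Corners of p in rows where p does not exceed q may be included: removing one
    leaves a shape not containing q, so no chain remains.\<close>
  also have "\<dots> = (\<Sum>i\<in>removable p. chains q n (dec p i))"
  proof (rule sum.mono_neutral_left)
    show "\<forall>i\<in>removable p - R. chains q n (dec p i) = 0"
    proof
      fix i assume "i \<in> removable p - R"
      then have i: "i \<in> removable p" "p i \<le> q i" by (auto simp: R_def)
      show "chains q n (dec p i) = 0"
      proof (rule ccontr)
        assume "chains q n (dec p i) \<noteq> 0"
        then have "q i \<le> dec p i i" using chains_support[OF young_dec[OF Suc.prems(1) i(1)]] by blast
        then show False using i removable_pos[OF i(1)] by (simp add: dec_def)
      qed
    qed
  qed (use Suc.prems in \<open>auto simp: R_def\<close>)
  finally show ?case by (simp add: chains_Suc_down)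
qed

lemma is_partition_sorted: "is_partition l \<Longrightarrow> sorted_wrt (\<ge>) l"
  by (simp add: is_partition_def)

lemma f_skew_eq_chains:
  assumes "is_partition l" "is_partition m" "diagram m \<subseteq> diagram l"
  shows "real (f_skew l m) = chains (row_fun m) (sum_list l - sum_list m) (row_fun l)"
proof -
  have y: "young (row_fun l)" "young (row_fun m)" using assms young_row_fun is_partition_sorted by auto
  have le: "row_fun m i \<le> row_fun l i" for i
  proof (rule ccontr)
    assume "\<not> row_fun m i \<le> row_fun l i"
    then have "(i, row_fun l i) \<in> cells (row_fun m) - cells (row_fun l)" by (simp add: cells_def)
    then show False using assms(3) by (auto simp: diagram_eq_cells)
  qed
  have "sum_list m \<le> sum_list l" using csize_mono[OF y(1) le] by (simp add: csize_row_fun)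
  then show ?thesis
    unfolding f_skew_def SYT_skew_eq_tableaux
    by (intro card_tableaux y le) (simp add: csize_row_fun)
qed

lemma f_shape_eq_tableau_count:
  assumes "is_partition l" shows "real (f_shape l) = tableau_count (row_fun l)"
  using f_skew_eq_chains[OF assms, of "[]"]
  by (simp add: f_shape_def tableau_count_def csize_row_fun row_fun_Nil is_partition_def diagram_def)

section \<open>The bound\<close>

lemma fact_mult_power_le: "fact m * real m ^ k \<le> fact (m + k)"
proof (induction k)
  case (Suc k)
  have "fact m * real m ^ Suc k = (fact m * real m ^ k) * real m" by simp
  also have "\<dots> \<le> fact (m + k) * real (Suc (m + k))" using Suc by (intro mult_mono) auto
  finally show ?case by (simp add: algebra_simps)
qed simp

text \<open>By the branching rule the normalized count is (n-K)!/n! times a shifted Schur value. Its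
  main term is (Y/(n-K))^K, and both this ratio and the error from
  \<open>strip_series_le_exp\<close> fit into the stated exponent.\<close>

lemma normalized_chains_le:
  fixes a :: real
  assumes xs: "sorted_wrt (\<ge>) xs" "real (length xs) \<le> a" "\<And>x. x \<in> set xs \<Longrightarrow> real x \<le> a"
    and p: "young p" and b: "1 \<le> b" "p 0 \<le> b" "\<And>i. b < i \<Longrightarrow> p i = 0" "b \<le> csize p"
    and a: "0 < a" and small: "256 * real (csize p) * a < real (sum_list xs)"
  shows "fact (csize p) * chains p (sum_list xs - csize p) (row_fun xs) / (tableau_count (row_fun xs) * tableau_count p)
    \<le> exp (1412 * real (csize p) * real b * a / real (sum_list xs))"
proof -
  define n where "n = sum_list xs"
  define K where "K = csize p"
  define ys where "ys = map (\<lambda>x. real x + real b) xs"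
  define Y where "Y = sum_list ys"
  define s where "s = real K * (a + real b) / Y"
  have K1: "1 \<le> real K" using b by (simp add: K_def)
  have small': "256 * real K * a < real n" using small by (simp add: K_def n_def)
  have "0 < 256 * real K * a" using K1 a by simp
  then have n0: "0 < real n" using small' by linarith
  then have "xs \<noteq> []" by (auto simp: n_def)
  then have "1 \<le> real (length xs)" by (cases xs) auto
  then have a1: "1 \<le> a" using xs(2) by linarith
  have Y: "Y = real n + real (length xs) * real b"
    unfolding Y_def ys_def n_def by (induction xs) (auto simp: algebra_simps)
  have "real n \<le> real (length xs) * a"
    unfolding n_def using xs(3) by (induction xs) (auto simp: algebra_simps intro: add_mono)
  also have "\<dots> \<le> a * a" using xs(2) a by (intro mult_right_mono) auto
  finally have "256 * real K * a < a * a" using small' by linarith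
  \<comment> \<open>At most a rows of length at most a give n \<le> a^2, so smallness of K a against
    n makes K, and hence b, smaller than a. The shifted rows are then at most 2a.\<close>
  then have Ka: "256 * real K < a" using a by simp
  have bK: "real b \<le> real K" using b by (simp add: K_def)
  have "real K * 1 \<le> real K * a" using a1 by (intro mult_left_mono) auto
  then have n2: "256 * real K < real n" using small' by linarith
  then have Kn: "K \<le> n" by linarith
  have Yn: "real n \<le> Y" using Y by simp
  then have Y0: "0 < Y" using n0 by linarith
  have s_le: "s \<le> 2 * real K * a / real n"
  proof -
    have "s \<le> real K * (2 * a) / Y" unfolding s_def using bK Ka K1 Y0
      by (intro divide_right_mono mult_left_mono) auto
    also have "\<dots> \<le> real K * (2 * a) / real n" using Yn n0 a by (intro divide_left_mono) auto
    finally show ?thesis by (simp add: mult_ac)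
  qed
  \<comment> \<open>The constant 256 is 2 * 128: the 2 comes from a + b \<le> 2a, the 128 from the
    condition on s.\<close>
  have "2 * real K * a / real n < 1 / 128" using small' n0 by (simp add: field_simps)
  then have s: "s \<le> 1 / 128" using s_le by linarith
  have "strip_series ys p \<le> tableau_count p * (Y ^ K / fact K) * exp (704 * (real b * s))"
    unfolding Y_def K_def s_def
  proof (rule strip_series_le_exp[OF p b(1,2,4)])
    show "0 \<le> y \<and> y \<le> a + real b" if "y \<in> set ys" for y using that xs(3) by (auto simp: ys_def)
    show "0 < sum_list ys" using Y0 by (simp add: Y_def)
    show "real (csize p) * (a + real b) / sum_list ys \<le> 1 / 128" using s by (simp add: s_def K_def Y_def)
  qed
  moreover have "shifted_schur xs p \<le> strip_series ys p"
    unfolding ys_def using shifted_schur_le_strip_series[OF xs(1) p b(3)] by blast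
  ultimately have "shifted_schur xs p \<le> tableau_count p * (Y ^ K / fact K) * exp (704 * (real b * s))" by linarith
  then have 1: "fact K * shifted_schur xs p / tableau_count p \<le> Y ^ K * exp (704 * (real b * s))"
    using tableau_count_pos[OF p] by (simp add: field_simps)
  have ch: "chains p (n - K) (row_fun xs) = fact (n - K) * (shifted_schur xs p * tableau_count (row_fun xs) / fact n)"
    using chains_eq_shifted_schur(2)[OF xs(1) p] Kn by (simp add: n_def K_def field_simps)
  have "fact K * chains p (n - K) (row_fun xs) / (tableau_count (row_fun xs) * tableau_count p) =
      fact (n - K) / fact n * (fact K * shifted_schur xs p / tableau_count p)"
    unfolding ch using tableau_count_pos[OF young_row_fun[OF xs(1)]] by simp
  also have "\<dots> \<le> fact (n - K) / fact n * (Y ^ K * exp (704 * (real b * s)))"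
    using 1 by (intro mult_left_mono) auto
  also have "\<dots> \<le> 1 / real (n - K) ^ K * (Y ^ K * exp (704 * (real b * s)))"
  proof (rule mult_right_mono)
    have "fact (n - K) * real (n - K) ^ K \<le> fact n" using fact_mult_power_le[of "n - K" K] Kn by simp
    moreover have "0 < real (n - K)" using n2 K1 Kn by (simp add: of_nat_diff)
    ultimately show "fact (n - K) / fact n \<le> 1 / real (n - K) ^ K" by (simp add: field_simps)
    show "0 \<le> Y ^ K * exp (704 * (real b * s))" using Y0 by simp
  qed
  also have "\<dots> = (Y / real (n - K)) ^ K * exp (704 * (real b * s))" by (simp add: power_divide)
  also have "\<dots> \<le> exp (4 * real K * real b * a / real n) * exp (1408 * real K * real b * a / real n)"
  proof (rule mult_mono)
    have nK: "0 < real (n - K)" "real n / 2 \<le> real (n - K)" using n2 K1 Kn by (simp_all add: of_nat_diff)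
    have ab: "real (length xs) * real b \<le> a * real b" "real K \<le> a * real b"
      using xs(2) Ka K1 b(1) a mult_mono[of "real K" a 1 "real b"] by (auto intro: mult_right_mono)
    have "Y / real (n - K) = 1 + (real (length xs) * real b + real K) / real (n - K)"
      using Y Kn nK by (simp add: field_simps of_nat_diff)
    also have "\<dots> \<le> 1 + (2 * (a * real b)) / (real n / 2)"
      using ab nK n0 by (intro add_left_mono frac_le) auto
    also have "\<dots> \<le> exp (4 * (a * real b) / real n)"
      using exp_ge_add_one_self[of "4 * (a * real b) / real n"] by simp
    finally have "(Y / real (n - K)) ^ K \<le> exp (4 * (a * real b) / real n) ^ K"
      using Y0 nK by (intro power_mono) auto
    also have "\<dots> = exp (4 * real K * real b * a / real n)"
      by (simp add: exp_of_nat_mult[symmetric] mult_ac)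
    finally show "(Y / real (n - K)) ^ K \<le> exp (4 * real K * real b * a / real n)" .
    have "704 * (real b * s) \<le> 704 * (real b * (2 * real K * a / real n))" using s_le by (intro mult_left_mono) auto
    then show "exp (704 * (real b * s)) \<le> exp (1408 * real K * real b * a / real n)" by (simp add: mult_ac)
  qed auto
  \<comment> \<open>1408 is 704 * 2 from the bound on s, and 4 is the cost of replacing n by Y and
    by n - K.\<close>
  also have "\<dots> = exp (1412 * real K * real b * a / real n)"
    by (simp add: exp_add[symmetric] add_divide_distrib[symmetric] algebra_simps)
  finally show ?thesis by (simp add: n_def K_def)
qed

lemma partition_le_num_cols: "is_partition l \<Longrightarrow> x \<in> set l \<Longrightarrow> x \<le> num_cols l"
  by (cases l) (auto simp: is_partition_def num_cols_def)

lemma row_fun_0: "row_fun l 0 = num_cols l"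
  by (cases l) (auto simp: num_cols_def row_fun_def)

lemma length_le_partition_sum: "is_partition l \<Longrightarrow> length l \<le> sum_list l"
  by (induction l) (auto simp: is_partition_def)

lemma num_cols_le_sum: "num_cols l \<le> sum_list l"
  by (cases l) (auto simp: num_cols_def)

theorem theorem1p8:
  shows "\<exists>C1 C2 :: real. C1 > 0 \<and> C2 > 0 \<and>
    (\<forall>(\<alpha> :: nat \<Rightarrow> real) (\<beta> :: nat \<Rightarrow> real) n k lam mu.
       (\<forall>m. \<alpha> m > 0) \<longrightarrow> (\<forall>m. \<beta> m > 0) \<longrightarrow>
       partition_of n lam \<longrightarrow> real (num_rows lam) \<le> \<alpha> n \<longrightarrow> real (num_cols lam) \<le> \<alpha> n \<longrightarrow>
       partition_of k mu \<longrightarrow> real (num_rows mu) \<le> \<beta> k \<longrightarrow> real (num_cols mu) \<le> \<beta> k \<longrightarrow>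
       diagram mu \<subseteq> diagram lam \<longrightarrow>
       real k < C1 * real n / \<alpha> n \<longrightarrow>
       A_skew lam mu \<le> exp (C2 * real k * \<beta> k * \<alpha> n / real n))"
proof (rule exI[of _ "1 / 256"], rule exI[of _ 1412], intro conjI allI impI)
  fix \<alpha> \<beta> :: "nat \<Rightarrow> real" and n k :: nat and lam mu :: "nat list"
  assume pos: "\<forall>m. \<alpha> m > 0" "\<forall>m. \<beta> m > 0" and lam: "partition_of n lam"
    and lam_le: "real (num_rows lam) \<le> \<alpha> n" "real (num_cols lam) \<le> \<alpha> n"
    and mu: "partition_of k mu" and mu_le: "real (num_rows mu) \<le> \<beta> k" "real (num_cols mu) \<le> \<beta> k"
    and sub: "diagram mu \<subseteq> diagram lam" and small: "real k < 1 / 256 * real n / \<alpha> n"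
  have part: "is_partition lam" "is_partition mu" and sums: "sum_list lam = n" "sum_list mu = k"
    using lam mu by (auto simp: partition_of_def)
  have y: "young (row_fun lam)" "young (row_fun mu)" using part young_row_fun is_partition_sorted by auto
  let ?p = "row_fun mu"
  have csz: "csize ?p = k" by (simp add: csize_row_fun sums)
  have A: "A_skew lam mu = fact k * chains ?p (n - k) (row_fun lam) / (tableau_count (row_fun lam) * tableau_count ?p)"
    unfolding A_skew_def f_shape_eq_tableau_count[OF part(1)] f_shape_eq_tableau_count[OF part(2)]
      f_skew_eq_chains[OF part sub] sums ..
  show "A_skew lam mu \<le> exp (1412 * real k * \<beta> k * \<alpha> n / real n)"
  proof (cases "k = 0")
    case True
    have "?p = (\<lambda>_. 0)" using csize_eq_0_iff[OF y(2)] csz True by simp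
    then have "A_skew lam mu = 1"
      using A True tableau_count_pos[OF y(1)] by (simp add: tableau_count_def csize_row_fun sums)
    then show ?thesis using True by simp
  next
    case False
    \<comment> \<open>\<open>\<beta> k\<close> is real and may exceed k, whereas the estimates take
      a natural number between 1 and k. The true side length of \<mu> qualifies when k > 0, and the
      exponent is monotone in it.\<close>
    define b where "b = max (num_rows mu) (num_cols mu)"
    have "mu \<noteq> []" using False sums by auto
    then have b1: "1 \<le> b" by (cases mu) (auto simp: b_def num_rows_def)
    have bk: "b \<le> k" unfolding b_def
      using length_le_partition_sum[OF part(2)] num_cols_le_sum[of mu] sums by (simp add: num_rows_def)
    have small': "256 * real k * \<alpha> n < real n" using small pos by (simp add: field_simps)
    have "A_skew lam mu \<le> exp (1412 * real k * real b * \<alpha> n / real n)"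
      unfolding A
    proof (rule normalized_chains_le[of lam "\<alpha> n" ?p b, unfolded csz sums])
      show "real x \<le> \<alpha> n" if "x \<in> set lam" for x
        using partition_le_num_cols[OF part(1) that] lam_le(2) by linarith
    qed (use part is_partition_sorted lam_le y b1 bk pos small' in
        \<open>auto simp: num_rows_def row_fun_0 b_def row_fun_def[of mu]\<close>)
    also have "\<dots> \<le> exp (1412 * real k * \<beta> k * \<alpha> n / real n)"
    proof -
      have "real b \<le> \<beta> k" using mu_le by (simp add: b_def)
      moreover have "0 \<le> \<alpha> n" using pos by (simp add: less_imp_le)
      ultimately have "1412 * real k * real b * \<alpha> n / real n \<le> 1412 * real k * \<beta> k * \<alpha> n / real n"
        by (intro divide_right_mono mult_right_mono mult_left_mono) auto
      then show ?thesis by simp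
    qed
    finally show ?thesis .
  qed
qed auto

end
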